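(* Let $\mathbb M$ be a partial group and let $\mathrm{aut}(\mathbb M)$ be its simplicial group of automorphisms. Then, with basepoint the identity, $$\pi_i(\mathrm{aut}(\mathbb M))\cong\begin{cases}\mathrm{Out}(\mathbb M),& i=0,\\ Z(\mathbb M),& i=1,\\ \{0\},& i\ge2.\end{cases}$$
   Context: Partial groups. A partial monoid is a nonempty simplicial set $\mathbb M$ with exactly one vertex $v$ such that for all $n\ge1$ the spine map $\mathbb M_n\to(\mathbb M_1)^n$, whose $i$-th component is induced by the map $[1]\to[n]$ with image $\{i-1,i\}$, is injective. The $n$-simplex with spine $(x_1,\dots,x_n)$ is written $[x_1|\dots|x_n]$. $\Pi\colon\mathbb M_n\to\mathbb M_1$ is induced by $[1]\to[n]$ with image $\{0,n\}$; $1=s_0(v)$. A partial group is a partial monoid with an inversion: a simplicial map $\nu\colon\mathbb M\to\mathbb M^{\mathrm{op}}$ with $\nu^{-1}=\nu^{\mathrm{op}}$ such that for every $u\in\mathbb M_n$, $n\ge1$, there is a simplex $[\nu(u)|u]\in\mathbb M_{2n}$ (concatenated spines) with $\Pi[\nu(u)|u]=1$. Homomorphisms are simplicial maps. With $\iota\in\Delta[1]_1$ the nondegenerate edge, $v_0=d_1\iota$, $v_1=d_0\iota$, a homotopy from $g$ to $f$ is $F\colon Y\times\Delta[1]\to X$ with $f=F\circ(\mathrm{Id}\times v_0)$, $g=F\circ(\mathrm{Id}\times v_1)$. Write $f\xleftarrow{\eta}g$ if there is such an $F$ with $F(1,\iota)=\eta$. $N(\mathbb M)$ is the set of $\eta\in\mathbb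 M_1$ for which there is an automorphism $c_\eta$ of $\mathbb M$ with $c_\eta\xleftarrow{\eta}1_{\mathbb M}$; it is a group under the product of $\mathbb M$. $Z(\mathbb M)=\{\eta\in N(\mathbb M):c_\eta=1_{\mathbb M}\}$, an abelian group. $\mathrm{Out}(\mathbb M)$ is the group of homotopy classes of automorphisms of $\mathbb M$, equal to $\mathrm{Aut}(\mathbb M)/\{c_\eta\}_{\eta\in N(\mathbb M)}$. For a simplicial set $X$, $\mathrm{Map}(X,X)$ is the simplicial set with $n$-simplices the simplicial maps $f\colon X\times\Delta[n]\to X$; with $\widetilde f=(f,\mathrm{pr}_2)\colon X\times\Delta[n]\to X\times\Delta[n]$, composition of the maps $\widetilde f$ makes it a simplicial monoid, and $\mathrm{aut}(X)\subseteq\mathrm{Map}(X,X)$ is the simplicial group of invertible elements in every dimension. *)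

theory Defs
  imports "HOL-Algebra.Coset" "HOL-Algebra.Elementary_Groups"
begin

section \<open>Simplicial sets\<close>

text \<open>An order-preserving map \<open>[m] \<rightarrow> [n]\<close> is encoded by the list of its values
  \<open>[\<theta> 0, \<dots>, \<theta> m]\<close>, so that its source is recovered from the length of the list.\<close>

definition ord_maps :: "nat \<Rightarrow> nat \<Rightarrow> nat list set" where
  "ord_maps m n = {\<theta>. length \<theta> = Suc m \<and> sorted \<theta> \<and> set \<theta> \<subseteq> {0..n}}"

definition ord_comp :: "nat list \<Rightarrow> nat list \<Rightarrow> nat list" where
  "ord_comp \<theta> \<phi> = map (\<lambda>j. \<theta> ! j) \<phi>"

definition ord_id :: "nat \<Rightarrow> nat list" where
  "ord_id n = [0..<Suc n]"

definition ord_const :: "nat \<Rightarrow> nat \<Rightarrow> nat list" where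
  "ord_const m j = replicate (Suc m) j"

text \<open>The injection \<open>[n - 1] \<rightarrow> [n]\<close> that omits \<open>i\<close>.\<close>
definition coface :: "nat \<Rightarrow> nat \<Rightarrow> nat list" where
  "coface n i = map (\<lambda>j. if j < i then j else Suc j) [0..<n]"

text \<open>\<open>act X n \<theta>\<close> is the operator \<open>X_n \<rightarrow> X_m\<close> induced by \<open>\<theta> : [m] \<rightarrow> [n]\<close>.  The sets
  \<open>simplices X n\<close> need not be disjoint, so the dimension is an argument of \<open>act\<close>.\<close>
record 'a sset =
  simplices :: "nat \<Rightarrow> 'a set"
  act :: "nat \<Rightarrow> nat list \<Rightarrow> 'a \<Rightarrow> 'a"

locale simplicial_set =
  fixes X :: "'a sset"
  assumes act_closed:
      "\<lbrakk>x \<in> simplices X n; \<theta> \<in> ord_maps m n\<rbrakk> \<Longrightarrow> act X n \<theta> x \<in> simplices X m"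
    and act_id: "x \<in> simplices X n \<Longrightarrow> act X n (ord_id n) x = x"
    and act_comp:
      "\<lbrakk>x \<in> simplices X n; \<theta> \<in> ord_maps m n; \<phi> \<in> ord_maps k m\<rbrakk>
        \<Longrightarrow> act X n (ord_comp \<theta> \<phi>) x = act X m \<phi> (act X n \<theta> x)"

definition face :: "'a sset \<Rightarrow> nat \<Rightarrow> nat \<Rightarrow> 'a \<Rightarrow> 'a" where
  "face X n i x = act X n (coface n i) x"

definition sset_prod :: "'a sset \<Rightarrow> 'b sset \<Rightarrow> ('a \<times> 'b) sset" where
  "sset_prod X Y = \<lparr>simplices = (\<lambda>n. simplices X n \<times> simplices Y n),
     act = (\<lambda>n \<theta> p. (act X n \<theta> (fst p), act Y n \<theta> (snd p)))\<rparr>"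

text \<open>The standard simplex \<open>\<Delta>[n]\<close>.\<close>
definition std_simplex :: "nat \<Rightarrow> nat list sset" where
  "std_simplex n = \<lparr>simplices = (\<lambda>m. ord_maps m n), act = (\<lambda>m \<theta> \<sigma>. ord_comp \<sigma> \<theta>)\<rparr>"

text \<open>\<open>ord_op n \<theta>\<close> is the conjugate \<open>i \<mapsto> n - \<theta>(m - i)\<close> of \<open>\<theta> : [m] \<rightarrow> [n]\<close>.\<close>
definition ord_op :: "nat \<Rightarrow> nat list \<Rightarrow> nat list" where
  "ord_op n \<theta> = map (\<lambda>j. n - j) (rev \<theta>)"

definition sset_op :: "'a sset \<Rightarrow> 'a sset" where
  "sset_op X = \<lparr>simplices = simplices X, act = (\<lambda>n \<theta>. act X n (ord_op n \<theta>))\<rparr>"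

text \<open>The components of a simplicial map are extensional functions, so that equality of
  simplicial maps is equality in HOL.\<close>
definition smaps :: "'a sset \<Rightarrow> 'b sset \<Rightarrow> (nat \<Rightarrow> 'a \<Rightarrow> 'b) set" where
  "smaps X Y = {f. (\<forall>n. f n \<in> simplices X n \<rightarrow>\<^sub>E simplices Y n) \<and>
     (\<forall>m n \<theta>. \<forall>x\<in>simplices X n. \<theta> \<in> ord_maps m n \<longrightarrow>
        f m (act X n \<theta> x) = act Y n \<theta> (f n x))}"

definition smap_id :: "'a sset \<Rightarrow> nat \<Rightarrow> 'a \<Rightarrow> 'a" where
  "smap_id X = (\<lambda>n. \<lambda>x\<in>simplices X n. x)"

definition smap_comp ::
  "'a sset \<Rightarrow> (nat \<Rightarrow> 'b \<Rightarrow> 'c) \<Rightarrow> (nat \<Rightarrow> 'a \<Rightarrow> 'b) \<Rightarrow> nat \<Rightarrow> 'a \<Rightarrow> 'c" where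
  "smap_comp X g f = (\<lambda>n. compose (simplices X n) (g n) (f n))"

definition End_monoid :: "'a sset \<Rightarrow> (nat \<Rightarrow> 'a \<Rightarrow> 'a) monoid" where
  "End_monoid X = \<lparr>carrier = smaps X X, mult = smap_comp X, one = smap_id X\<rparr>"

definition Aut_group :: "'a sset \<Rightarrow> (nat \<Rightarrow> 'a \<Rightarrow> 'a) monoid" where
  "Aut_group X = units_of (End_monoid X)"


section \<open>Partial groups\<close>

definition spine :: "'a sset \<Rightarrow> nat \<Rightarrow> 'a \<Rightarrow> 'a list" where
  "spine X n x = map (\<lambda>i. act X n [i, Suc i] x) [0..<n]"

definition total_prod :: "'a sset \<Rightarrow> nat \<Rightarrow> 'a \<Rightarrow> 'a" where
  "total_prod X n x = act X n [0, n] x"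

locale partial_monoid = simplicial_set M for M :: "'a sset" +
  assumes unique_vertex: "\<exists>!v. v \<in> simplices M 0"
    and spine_inj: "n \<ge> 1 \<Longrightarrow> inj_on (spine M n) (simplices M n)"

definition punit :: "'a sset \<Rightarrow> 'a" where
  "punit M = act M 0 [0, 0] (THE v. v \<in> simplices M 0)"

text \<open>Since \<open>\<nu>\<close> and \<open>\<nu>\<^sup>o\<^sup>p\<close> have the same underlying functions, \<open>\<nu>\<inverse> = \<nu>\<^sup>o\<^sup>p\<close> says that
  every component of \<open>\<nu>\<close> is an involution.\<close>
definition is_inversion :: "'a sset \<Rightarrow> (nat \<Rightarrow> 'a \<Rightarrow> 'a) \<Rightarrow> bool" where
  "is_inversion M \<nu> \<longleftrightarrow>
     \<nu> \<in> smaps M (sset_op M) \<and>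
     (\<forall>n. \<forall>u\<in>simplices M n. \<nu> n (\<nu> n u) = u) \<and>
     (\<forall>n\<ge>1. \<forall>u\<in>simplices M n. \<exists>w\<in>simplices M (2 * n).
        spine M (2 * n) w = spine M n (\<nu> n u) @ spine M n u \<and>
        total_prod M (2 * n) w = punit M)"

locale partial_group = partial_monoid M for M :: "'a sset" +
  assumes inversion_exists: "\<exists>\<nu>. is_inversion M \<nu>"

text \<open>The product of \<open>x\<close> and \<open>y\<close>, meaningful only if the simplex \<open>[x|y]\<close> exists.\<close>
definition pmult :: "'a sset \<Rightarrow> 'a \<Rightarrow> 'a \<Rightarrow> 'a" where
  "pmult M x y = total_prod M 2 (THE w. w \<in> simplices M 2 \<and> spine M 2 w = [x, y])"


section \<open>Homotopies, normalizer, center and outer automorphisms\<close>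

text \<open>The nondegenerate edge \<open>\<iota>\<close> of \<open>\<Delta>[1]\<close> is \<open>[0, 1]\<close>; its faces are \<open>v_0 = d_1 \<iota> = [0]\<close> and
  \<open>v_1 = d_0 \<iota> = [1]\<close>, with degeneracies the constant lists.\<close>
definition smap_end ::
  "'a sset \<Rightarrow> (nat \<Rightarrow> 'a \<times> nat list \<Rightarrow> 'b) \<Rightarrow> nat \<Rightarrow> nat \<Rightarrow> 'a \<Rightarrow> 'b" where
  "smap_end X F j = (\<lambda>n. \<lambda>x\<in>simplices X n. F n (x, ord_const n j))"

definition homotopy_from_to ::
  "'a sset \<Rightarrow> 'b sset \<Rightarrow> (nat \<Rightarrow> 'a \<Rightarrow> 'b) \<Rightarrow> (nat \<Rightarrow> 'a \<Rightarrow> 'b)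
    \<Rightarrow> (nat \<Rightarrow> 'a \<times> nat list \<Rightarrow> 'b) \<Rightarrow> bool" where
  "homotopy_from_to X Y g f F \<longleftrightarrow>
     F \<in> smaps (sset_prod X (std_simplex 1)) Y \<and> smap_end X F 0 = f \<and> smap_end X F 1 = g"

text \<open>\<open>homotopic_via M f \<eta> g\<close> is the relation \<open>f \<leftarrow>\<^sup>\<eta> g\<close>.\<close>
definition homotopic_via ::
  "'a sset \<Rightarrow> (nat \<Rightarrow> 'a \<Rightarrow> 'a) \<Rightarrow> 'a \<Rightarrow> (nat \<Rightarrow> 'a \<Rightarrow> 'a) \<Rightarrow> bool" where
  "homotopic_via M f \<eta> g \<longleftrightarrow>
     (\<exists>F. homotopy_from_to M M g f F \<and> F 1 (punit M, [0, 1]) = \<eta>)"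

definition normalizer :: "'a sset \<Rightarrow> 'a set" where
  "normalizer M = {\<eta> \<in> simplices M 1.
     \<exists>c\<in>carrier (Aut_group M). homotopic_via M c \<eta> (smap_id M)}"

definition conj_aut :: "'a sset \<Rightarrow> 'a \<Rightarrow> nat \<Rightarrow> 'a \<Rightarrow> 'a" where
  "conj_aut M \<eta> = (THE c. c \<in> carrier (Aut_group M) \<and> homotopic_via M c \<eta> (smap_id M))"

definition center :: "'a sset \<Rightarrow> 'a set" where
  "center M = {\<eta> \<in> normalizer M. conj_aut M \<eta> = smap_id M}"

definition center_group :: "'a sset \<Rightarrow> 'a monoid" where
  "center_group M = \<lparr>carrier = center M, mult = pmult M, one = punit M\<rparr>"

definition aut_htpy_rel :: "'a sset \<Rightarrow> ((nat \<Rightarrow> 'a \<Rightarrow> 'a) \<times> (nat \<Rightarrow> 'a \<Rightarrow> 'a)) set" where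
  "aut_htpy_rel X = {(g, f). g \<in> carrier (Aut_group X) \<and> f \<in> carrier (Aut_group X) \<and>
     (\<exists>F. homotopy_from_to X X g f F)}"

definition Out_group :: "'a sset \<Rightarrow> (nat \<Rightarrow> 'a \<Rightarrow> 'a) set monoid" where
  "Out_group X = \<lparr>carrier = carrier (Aut_group X) // aut_htpy_rel X,
     mult = set_mult (Aut_group X), one = aut_htpy_rel X `` {smap_id X}\<rparr>"


section \<open>The simplicial monoid \<open>Map(X, X)\<close> and the simplicial group \<open>aut(X)\<close>\<close>

definition Map_sset :: "'a sset \<Rightarrow> (nat \<Rightarrow> 'a \<times> nat list \<Rightarrow> 'a) sset" where
  "Map_sset X = \<lparr>simplices = (\<lambda>n. smaps (sset_prod X (std_simplex n)) X),
     act = (\<lambda>n \<theta> f k. \<lambda>p \<in> simplices X k \<times> ord_maps k (length \<theta> - 1).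
              f k (fst p, ord_comp \<theta> (snd p)))\<rparr>"

definition smap_tilde ::
  "'a sset \<Rightarrow> nat \<Rightarrow> (nat \<Rightarrow> 'a \<times> nat list \<Rightarrow> 'a) \<Rightarrow> nat \<Rightarrow> 'a \<times> nat list \<Rightarrow> 'a \<times> nat list" where
  "smap_tilde X n f = (\<lambda>k. \<lambda>p \<in> simplices X k \<times> ord_maps k n. (f k p, snd p))"

text \<open>The product \<open>f \<circ> g~\<close> is the unique \<open>h\<close> with \<open>h~ = f~ \<circ> g~\<close>, and \<open>pr_1\<close> is the unique \<open>h\<close>
  with \<open>h~ = id\<close>.\<close>
definition Map_monoid :: "'a sset \<Rightarrow> nat \<Rightarrow> (nat \<Rightarrow> 'a \<times> nat list \<Rightarrow> 'a) monoid" where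
  "Map_monoid X n = \<lparr>carrier = simplices (Map_sset X) n,
     mult = (\<lambda>f g. smap_comp (sset_prod X (std_simplex n)) f (smap_tilde X n g)),
     one = (\<lambda>k. \<lambda>p \<in> simplices X k \<times> ord_maps k n. fst p)\<rparr>"

definition aut_level :: "'a sset \<Rightarrow> nat \<Rightarrow> (nat \<Rightarrow> 'a \<times> nat list \<Rightarrow> 'a) monoid" where
  "aut_level X n = units_of (Map_monoid X n)"

definition aut_sset :: "'a sset \<Rightarrow> (nat \<Rightarrow> 'a \<times> nat list \<Rightarrow> 'a) sset" where
  "aut_sset X = \<lparr>simplices = (\<lambda>n. carrier (aut_level X n)), act = act (Map_sset X)\<rparr>"


section \<open>Homotopy groups\<close>

text \<open>The combinatorial homotopy groups of a Kan complex \<open>X\<close> at a vertex \<open>b\<close> (May, Simplicial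
  Objects in Algebraic Topology, Sections 3 and 4); every simplicial group is a Kan complex.\<close>

definition const_simplex :: "'a sset \<Rightarrow> 'a \<Rightarrow> nat \<Rightarrow> 'a" where
  "const_simplex X b n = act X 0 (ord_const n 0) b"

definition spheres :: "'a sset \<Rightarrow> 'a \<Rightarrow> nat \<Rightarrow> 'a set" where
  "spheres X b n = {x \<in> simplices X n.
     n = 0 \<or> (\<forall>i\<le>n. face X n i x = const_simplex X b (n - 1))}"

definition sphere_rel :: "'a sset \<Rightarrow> 'a \<Rightarrow> nat \<Rightarrow> ('a \<times> 'a) set" where
  "sphere_rel X b n = {(x, x'). x \<in> spheres X b n \<and> x' \<in> spheres X b n \<and>
     (\<exists>y\<in>simplices X (Suc n). face X (Suc n) n y = x \<and> face X (Suc n) (Suc n) y = x' \<and>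
        (\<forall>i<n. face X (Suc n) i y = const_simplex X b n))}"

definition homotopy_set :: "'a sset \<Rightarrow> 'a \<Rightarrow> nat \<Rightarrow> 'a set set" where
  "homotopy_set X b n = spheres X b n // sphere_rel X b n"

text \<open>For \<open>n \<ge> 1\<close> only.  The product of the classes of \<open>x\<close> and \<open>y\<close> is the class of \<open>d_n z\<close>, where
  \<open>d_(n-1) z = x\<close>, \<open>d_(n+1) z = y\<close> and \<open>d_i z\<close> is the basepoint for \<open>i < n - 1\<close>.\<close>
definition homotopy_group :: "'a sset \<Rightarrow> 'a \<Rightarrow> nat \<Rightarrow> 'a set monoid" where
  "homotopy_group X b n = \<lparr>carrier = homotopy_set X b n,
     mult = (\<lambda>A B. sphere_rel X b n `` {face X (Suc n) n z | z. z \<in> simplices X (Suc n) \<and>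
        face X (Suc n) (n - 1) z \<in> A \<and> face X (Suc n) (Suc n) z \<in> B \<and>
        (\<forall>i<n - 1. face X (Suc n) i z = const_simplex X b n)}),
     one = sphere_rel X b n `` {const_simplex X b n}\<rparr>"

definition pi_aut :: "nat \<Rightarrow> 'a sset \<Rightarrow> (nat \<Rightarrow> 'a \<times> nat list \<Rightarrow> 'a) set monoid" where
  "pi_aut i X = homotopy_group (aut_sset X) \<one>\<^bsub>aut_level X 0\<^esub> i"

text \<open>The set \<open>\<pi>\<^sub>0\<close> of a simplicial group inherits its multiplication from the group of
  vertices.\<close>
definition pi0_aut :: "'a sset \<Rightarrow> (nat \<Rightarrow> 'a \<times> nat list \<Rightarrow> 'a) set monoid" where
  "pi0_aut X = \<lparr>carrier = homotopy_set (aut_sset X) \<one>\<^bsub>aut_level X 0\<^esub> 0,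
     mult = set_mult (aut_level X 0),
     one = sphere_rel (aut_sset X) \<one>\<^bsub>aut_level X 0\<^esub> 0 `` {\<one>\<^bsub>aut_level X 0\<^esub>}\<rparr>"

end

theory Submission
  imports Defs
begin

text \<open>A simplex of a partial group is determined by its edges, so a map
  \<open>F : M \<times> \<Delta>[n] \<rightarrow> M\<close> is determined by its values \<open>F (x, [i, j])\<close>.  The squares
  \<open>{x} \<times> [i, j]\<close> give \<open>F (x, [i, i]) \<eta> = F (x, [i, j]) = \<eta> F (x, [j, j])\<close> with
  \<open>\<eta> = F (1, [i, j])\<close>.  For \<open>n \<ge> 2\<close> every edge of \<open>\<Delta>[n]\<close> lies in a proper face, so a
  spherical \<open>n\<close>-simplex of \<open>aut(M)\<close> is constant.  A spherical 1-simplex is a homotopy from the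
  identity to itself, hence amounts to a central \<open>\<eta>\<close>; products in \<open>\<pi>\<^sub>1\<close> are those of the
  group \<open>aut(M)\<^sub>1\<close>, because a 2-simplex is determined by its outer faces.  The group
  \<open>\<pi>\<^sub>0\<close> is the quotient of the vertices by the homotopies that are invertible as
  1-simplices of \<open>Map(M, M)\<close>, and any homotopy between automorphisms is invertible: with the
  inversion \<open>\<nu>\<close>, the homotopy can be run backwards.\<close>

section \<open>Order-preserving maps\<close>

lemma ord_maps_nth:
  assumes "\<theta> \<in> ord_maps m n" "i \<le> j" "j \<le> m"
  shows "\<theta> ! i \<le> \<theta> ! j" "\<theta> ! j \<le> n"
proof -
  show "\<theta> ! i \<le> \<theta> ! j" using assms by (simp add: ord_maps_def sorted_nth_mono)
  have "\<theta> ! j \<in> set \<theta>" using assms by (simp add: ord_maps_def)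
  then have "\<theta> ! j \<in> {0..n}" using assms(1) unfolding ord_maps_def by blast
  then show "\<theta> ! j \<le> n" by simp
qed

lemma ord_comp_closed:
  assumes "\<theta> \<in> ord_maps m n" "\<phi> \<in> ord_maps k m"
  shows "ord_comp \<theta> \<phi> \<in> ord_maps k n"
proof -
  have \<phi>: "sorted_wrt (\<le>) \<phi>" "\<forall>j\<in>set \<phi>. j \<le> m"
    using assms by (auto simp: ord_maps_def)
  have "sorted (map (\<lambda>j. \<theta> ! j) \<phi>)"
    unfolding sorted_map
    by (rule sorted_wrt_mono_rel[OF _ \<phi>(1)]) (use \<phi>(2) ord_maps_nth(1)[OF assms(1)] in blast)
  moreover have "\<theta> ! j \<in> {0..n}" if "j \<in> set \<phi>" for j
    using ord_maps_nth(2)[OF assms(1) le_refl] \<phi> that by simp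
  ultimately show ?thesis
    using assms by (auto simp: ord_maps_def ord_comp_def)
qed

lemma ord_comp_assoc:
  assumes "\<phi> \<in> ord_maps k m" "\<psi> \<in> ord_maps l k"
  shows "ord_comp (ord_comp \<theta> \<phi>) \<psi> = ord_comp \<theta> (ord_comp \<phi> \<psi>)"
  using assms by (auto simp: ord_comp_def ord_maps_def)

lemma ord_comp_id_right [simp]: "\<theta> \<in> ord_maps m n \<Longrightarrow> ord_comp \<theta> (ord_id m) = \<theta>"
  using map_nth[of \<theta>] by (simp add: ord_comp_def ord_id_def ord_maps_def del: upt_Suc)

lemma ord_comp_id_left [simp]: "\<theta> \<in> ord_maps m n \<Longrightarrow> ord_comp (ord_id n) \<theta> = \<theta>"
  by (rule map_idI[of \<theta> "\<lambda>j. ord_id n ! j", folded ord_comp_def])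
    (auto simp: ord_id_def ord_maps_def simp del: upt_Suc)

lemma ord_id_closed [simp]: "ord_id n \<in> ord_maps n n"
  by (auto simp: ord_id_def ord_maps_def simp del: upt_Suc)

lemma ord_const_closed [simp]: "j \<le> n \<Longrightarrow> ord_const m j \<in> ord_maps m n"
  by (auto simp: ord_const_def ord_maps_def)

lemma ord_maps_0: "\<sigma> \<in> ord_maps k 0 \<longleftrightarrow> \<sigma> = ord_const k 0"
proof
  assume "\<sigma> \<in> ord_maps k 0"
  then show "\<sigma> = ord_const k 0"
    unfolding ord_const_def by (intro replicate_eqI) (auto simp: ord_maps_def)
qed simp

lemma coface_closed:
  assumes "1 \<le> n" "i \<le> n"
  shows "coface n i \<in> ord_maps (n - 1) n"
proof -
  have "sorted (coface n i)"
    unfolding coface_def sorted_map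
    by (rule sorted_wrt_mono_rel[of _ "(\<le>)"]) auto
  then show ?thesis
    using assms by (auto simp: ord_maps_def coface_def)
qed

lemma ord_maps_1: "\<sigma> \<in> ord_maps 1 n \<longleftrightarrow> (\<exists>i j. \<sigma> = [i, j] \<and> i \<le> j \<and> j \<le> n)"
  by (auto simp: ord_maps_def length_Suc_conv)

section \<open>Simplicial maps\<close>

lemma smaps_closed:
  "f \<in> smaps X Y \<Longrightarrow> x \<in> simplices X n \<Longrightarrow> f n x \<in> simplices Y n"
  by (auto simp: smaps_def)

lemma smaps_natural:
  "\<lbrakk>f \<in> smaps X Y; x \<in> simplices X n; \<theta> \<in> ord_maps m n\<rbrakk>
    \<Longrightarrow> f m (act X n \<theta> x) = act Y n \<theta> (f n x)"
  by (auto simp: smaps_def)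

lemma smaps_eqI:
  assumes "f \<in> smaps X Y" "g \<in> smaps X Y"
    and "\<And>n x. x \<in> simplices X n \<Longrightarrow> f n x = g n x"
  shows "f = g"
proof
  fix n
  have "f n \<in> extensional (simplices X n)" "g n \<in> extensional (simplices X n)"
    using assms by (auto simp: smaps_def PiE_def)
  then show "f n = g n"
    using assms(3) by (rule extensionalityI)
qed

lemma smapsI:
  assumes "\<And>n. f n \<in> extensional (simplices X n)"
    and "\<And>n x. x \<in> simplices X n \<Longrightarrow> f n x \<in> simplices Y n"
    and "\<And>m n \<theta> x. \<lbrakk>x \<in> simplices X n; \<theta> \<in> ord_maps m n\<rbrakk>
        \<Longrightarrow> f m (act X n \<theta> x) = act Y n \<theta> (f n x)"
  shows "f \<in> smaps X Y"
  using assms by (auto simp: smaps_def PiE_def)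

abbreviation maps_from_prism where
  "maps_from_prism X n Y \<equiv> smaps (sset_prod X (std_simplex n)) Y"

lemma prism_simplices [simp]:
  "simplices (sset_prod X (std_simplex n)) k = simplices X k \<times> ord_maps k n"
  by (simp add: sset_prod_def std_simplex_def)

lemma prism_act [simp]:
  "act (sset_prod X (std_simplex n)) k \<theta> (x, \<sigma>) = (act X k \<theta> x, ord_comp \<sigma> \<theta>)"
  by (simp add: sset_prod_def std_simplex_def)

lemma prism_closed:
  "\<lbrakk>F \<in> maps_from_prism X n Y; x \<in> simplices X k; \<sigma> \<in> ord_maps k n\<rbrakk>
    \<Longrightarrow> F k (x, \<sigma>) \<in> simplices Y k"
  by (rule smaps_closed) auto

lemma prism_natural:
  assumes "F \<in> maps_from_prism X n Y" "x \<in> simplices X k" "\<sigma> \<in> ord_maps k n" "\<theta> \<in> ord_maps m k"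
  shows "act Y k \<theta> (F k (x, \<sigma>)) = F m (act X k \<theta> x, ord_comp \<sigma> \<theta>)"
  using smaps_natural[OF assms(1), of "(x, \<sigma>)" k \<theta> m] assms by simp

lemma prism_eqI:
  assumes "F \<in> maps_from_prism X n Y" "G \<in> maps_from_prism X n Y"
    and "\<And>k x \<sigma>. \<lbrakk>x \<in> simplices X k; \<sigma> \<in> ord_maps k n\<rbrakk> \<Longrightarrow> F k (x, \<sigma>) = G k (x, \<sigma>)"
  shows "F = G"
  using assms by (intro smaps_eqI) auto

lemma prismI:
  assumes "\<And>k. F k \<in> extensional (simplices X k \<times> ord_maps k n)"
    and "\<And>k x \<sigma>. \<lbrakk>x \<in> simplices X k; \<sigma> \<in> ord_maps k n\<rbrakk> \<Longrightarrow> F k (x, \<sigma>) \<in> simplices Y k"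
    and "\<And>k m x \<sigma> \<theta>. \<lbrakk>x \<in> simplices X k; \<sigma> \<in> ord_maps k n; \<theta> \<in> ord_maps m k\<rbrakk>
        \<Longrightarrow> F m (act X k \<theta> x, ord_comp \<sigma> \<theta>) = act Y k \<theta> (F k (x, \<sigma>))"
  shows "F \<in> maps_from_prism X n Y"
  using assms by (intro smapsI) auto

section \<open>The simplicial group of automorphisms\<close>

text \<open>The dimension argument \<open>n'\<close> is arbitrary: \<open>Map_sset\<close> reads the
  dimension of the result off the length of \<open>\<theta>\<close>.\<close>

lemma Map_act_apply [simp]:
  "\<lbrakk>\<theta> \<in> ord_maps m n; x \<in> simplices X k; \<sigma> \<in> ord_maps k m\<rbrakk>
    \<Longrightarrow> act (Map_sset X) n' \<theta> f k (x, \<sigma>) = f k (x, ord_comp \<theta> \<sigma>)"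
  by (simp add: Map_sset_def ord_maps_def[of m n])

text \<open>Over a fixed \<open>\<sigma>\<close> the product is plain composition of maps of
  \<open>simplices X k\<close>, so the monoid laws can be checked fibre by fibre.\<close>

lemma Map_mult_apply [simp]:
  "\<lbrakk>x \<in> simplices X k; \<sigma> \<in> ord_maps k n\<rbrakk>
    \<Longrightarrow> (f \<otimes>\<^bsub>Map_monoid X n\<^esub> g) k (x, \<sigma>) = f k (g k (x, \<sigma>), \<sigma>)"
  by (simp add: Map_monoid_def smap_comp_def smap_tilde_def compose_def)

lemma Map_one_apply [simp]:
  "\<lbrakk>x \<in> simplices X k; \<sigma> \<in> ord_maps k n\<rbrakk> \<Longrightarrow> \<one>\<^bsub>Map_monoid X n\<^esub> k (x, \<sigma>) = x"
  by (simp add: Map_monoid_def)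

lemma Map_carrier [simp]: "carrier (Map_monoid X n) = maps_from_prism X n X"
  by (simp add: Map_monoid_def Map_sset_def)

lemma Map_mult_extensional:
  "(f \<otimes>\<^bsub>Map_monoid X n\<^esub> g) k \<in> extensional (simplices X k \<times> ord_maps k n)"
  by (simp add: Map_monoid_def smap_comp_def compose_def)

lemma Map_one_extensional:
  "\<one>\<^bsub>Map_monoid X n\<^esub> k \<in> extensional (simplices X k \<times> ord_maps k n)"
  by (simp add: Map_monoid_def)

context simplicial_set
begin

lemma Map_mult_closed:
  assumes "f \<in> maps_from_prism X n X" "g \<in> maps_from_prism X n X"
  shows "f \<otimes>\<^bsub>Map_monoid X n\<^esub> g \<in> maps_from_prism X n X"
  by (rule prismI)
    (simp_all add: Map_mult_extensional assms prism_closed[of _ X n X] prism_natural[of _ X n X]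
      act_closed ord_comp_closed)

lemma Map_one_closed: "\<one>\<^bsub>Map_monoid X n\<^esub> \<in> maps_from_prism X n X"
  by (rule prismI) (simp_all add: Map_one_extensional act_closed ord_comp_closed)

lemma monoid_Map: "monoid (Map_monoid X n)"
  by (rule monoidI)
    (auto simp: Map_mult_closed Map_one_closed prism_closed[of _ X n X]
      intro!: prism_eqI[of _ X n X])

lemma Map_act_closed:
  assumes "\<theta> \<in> ord_maps m n" "f \<in> maps_from_prism X n X"
  shows "act (Map_sset X) n' \<theta> f \<in> maps_from_prism X m X"
proof (rule prismI)
  show "act (Map_sset X) n' \<theta> f k \<in> extensional (simplices X k \<times> ord_maps k m)" for k
    using assms by (simp add: Map_sset_def ord_maps_def[of m n])
next
  fix k x \<sigma> assume "x \<in> simplices X k" "\<sigma> \<in> ord_maps k m"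
  then show "act (Map_sset X) n' \<theta> f k (x, \<sigma>) \<in> simplices X k"
    by (simp add: Map_act_apply[OF assms(1)] prism_closed[OF assms(2)] ord_comp_closed[OF assms(1)])
next
  fix k l x \<sigma> \<phi> assume "x \<in> simplices X k" "\<sigma> \<in> ord_maps k m" "\<phi> \<in> ord_maps l k"
  then show "act (Map_sset X) n' \<theta> f l (act X k \<phi> x, ord_comp \<sigma> \<phi>) =
      act X k \<phi> (act (Map_sset X) n' \<theta> f k (x, \<sigma>))"
    by (simp add: Map_act_apply[OF assms(1)] prism_natural[OF assms(2)] ord_comp_closed[OF assms(1)]
        ord_comp_closed act_closed ord_comp_assoc)
qed

lemma Map_act_mult:
  assumes "\<theta> \<in> ord_maps m n" "f \<in> maps_from_prism X n X" "g \<in> maps_from_prism X n X"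
  shows "act (Map_sset X) n' \<theta> (f \<otimes>\<^bsub>Map_monoid X n\<^esub> g) =
    act (Map_sset X) n' \<theta> f \<otimes>\<^bsub>Map_monoid X m\<^esub> act (Map_sset X) n' \<theta> g"
  by (rule prism_eqI[of _ X m X])
    (use assms in \<open>simp_all add: Map_act_closed Map_mult_closed Map_act_apply[OF assms(1)]
      ord_comp_closed[OF assms(1)] prism_closed\<close>)

lemma Map_act_one:
  assumes "\<theta> \<in> ord_maps m n"
  shows "act (Map_sset X) n' \<theta> \<one>\<^bsub>Map_monoid X n\<^esub> = \<one>\<^bsub>Map_monoid X m\<^esub>"
  by (rule prism_eqI[of _ X m X])
    (use assms in \<open>simp_all add: Map_act_closed Map_one_closed Map_act_apply[OF assms(1)]
      ord_comp_closed[OF assms(1)]\<close>)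

lemma Map_act_comp:
  assumes "\<theta> \<in> ord_maps m n" "\<phi> \<in> ord_maps l m" "f \<in> maps_from_prism X n X"
  shows "act (Map_sset X) n' \<phi> (act (Map_sset X) n'' \<theta> f) = act (Map_sset X) l' (ord_comp \<theta> \<phi>) f"
  by (rule prism_eqI[of _ X l X])
    (use assms in \<open>simp_all add: Map_act_closed[OF assms(2)] Map_act_closed[OF assms(1)]
       Map_act_closed[OF ord_comp_closed[OF assms(1,2)]] Map_act_apply[OF assms(1)]
       Map_act_apply[OF assms(2)] Map_act_apply[OF ord_comp_closed[OF assms(1,2)]]
       ord_comp_closed[OF assms(2)] ord_comp_assoc[OF assms(2)]\<close>)

lemma Map_act_id:
  assumes "f \<in> maps_from_prism X n X"
  shows "act (Map_sset X) n' (ord_id n) f = f"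
  by (rule prism_eqI[of _ X n X])
    (use assms in \<open>simp_all add: Map_act_closed[OF ord_id_closed] Map_act_apply[OF ord_id_closed]\<close>)


lemma group_aut_level: "group (aut_level X n)"
  unfolding aut_level_def by (rule monoid.units_group[OF monoid_Map])

text \<open>Operators only reindex the fibres in which products are formed. They are therefore
  monoid homomorphisms, send inverses to inverses and restrict to units; this makes
  \<open>aut_sset\<close> a simplicial group.\<close>

lemma act_aut_hom:
  assumes "\<theta> \<in> ord_maps m n"
  shows "group_hom (aut_level X n) (aut_level X m) (act (aut_sset X) n' \<theta>)"
proof -
  let ?h = "act (Map_sset X) n' \<theta>"
  have "?h f \<in> Units (Map_monoid X m)" if "f \<in> Units (Map_monoid X n)" for f
  proof -
    from that obtain g where fg: "f \<in> maps_from_prism X n X" "g \<in> maps_from_prism X n X"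
      "g \<otimes>\<^bsub>Map_monoid X n\<^esub> f = \<one>\<^bsub>Map_monoid X n\<^esub>" "f \<otimes>\<^bsub>Map_monoid X n\<^esub> g = \<one>\<^bsub>Map_monoid X n\<^esub>"
      by (auto simp: Units_def)
    have "?h g \<otimes>\<^bsub>Map_monoid X m\<^esub> ?h f = \<one>\<^bsub>Map_monoid X m\<^esub>"
         "?h f \<otimes>\<^bsub>Map_monoid X m\<^esub> ?h g = \<one>\<^bsub>Map_monoid X m\<^esub>"
      using fg by (simp_all add: Map_act_mult[OF assms, symmetric] Map_act_one[OF assms])
    then show ?thesis
      using fg Map_act_closed[OF assms] unfolding Units_def by auto
  qed
  moreover have "?h (f \<otimes>\<^bsub>Map_monoid X n\<^esub> g) = ?h f \<otimes>\<^bsub>Map_monoid X m\<^esub> ?h g"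
    if "f \<in> Units (Map_monoid X n)" "g \<in> Units (Map_monoid X n)" for f g
    using that by (intro Map_act_mult[OF assms]) (auto simp: Units_def)
  ultimately show ?thesis
    unfolding group_hom_def group_hom_axioms_def hom_def
    using group_aut_level by (auto simp: aut_sset_def aut_level_def units_of_def)
qed

lemma aut_act_comp:
  assumes "\<theta> \<in> ord_maps m n" "\<phi> \<in> ord_maps l m" "f \<in> carrier (aut_level X n)"
  shows "act (aut_sset X) n' \<phi> (act (aut_sset X) n'' \<theta> f) = act (aut_sset X) l' (ord_comp \<theta> \<phi>) f"
  using assms Map_act_comp[OF assms(1,2)]
  by (auto simp: aut_sset_def aut_level_def units_of_def Units_def)

lemma aut_act_id:
  assumes "f \<in> carrier (aut_level X n)"
  shows "act (aut_sset X) n' (ord_id n) f = f"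
  using assms Map_act_id by (auto simp: aut_sset_def aut_level_def units_of_def Units_def)

lemma const_simplex_aut:
  "const_simplex (aut_sset X) \<one>\<^bsub>aut_level X 0\<^esub> n = \<one>\<^bsub>aut_level X n\<^esub>"
  unfolding const_simplex_def by (rule group_hom.hom_one[OF act_aut_hom]) simp

lemma face_aut_hom:
  assumes "i \<le> Suc n"
  shows "group_hom (aut_level X (Suc n)) (aut_level X n) (face (aut_sset X) (Suc n) i)"
proof -
  have "face (aut_sset X) (Suc n) i = act (aut_sset X) (Suc n) (coface (Suc n) i)"
    by (simp add: fun_eq_iff face_def)
  then show ?thesis
    using act_aut_hom[OF coface_closed[of "Suc n" i]] assms by simp
qed

end

section \<open>Faces and components of the simplicial group of automorphisms\<close>

lemma simplices_aut [simp]: "simplices (aut_sset X) n = carrier (aut_level X n)"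
  by (simp add: aut_sset_def)

lemma ord_list_simps:
  "ord_id 0 = [0]" "ord_id (Suc 0) = [0, 1]"
  "coface (Suc 0) 0 = [Suc 0]" "coface (Suc 0) (Suc 0) = [0]"
  "coface (Suc (Suc 0)) 0 = [1, 2]" "coface (Suc (Suc 0)) (Suc 0) = [0, 2]"
  "coface (Suc (Suc 0)) (Suc (Suc 0)) = [0, 1]"
  by (simp_all add: ord_id_def coface_def)

text \<open>\<open>R\<close> is the image of \<open>(d, e)\<close>, a subgroup of
  \<open>G0 \<times> G0\<close>, and it contains the diagonal because \<open>s\<close> is a common
  section; such a relation is a congruence. In the application \<open>d\<close>, \<open>e\<close>,
  \<open>s\<close> are two faces and a degeneracy of a simplicial group.\<close>

lemma graph_of_homs_cosets:
  assumes d: "group_hom G1 G0 d" and e: "group_hom G1 G0 e" and s: "group_hom G0 G1 s"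
    and sect: "\<And>x. x \<in> carrier G0 \<Longrightarrow> d (s x) = x" "\<And>x. x \<in> carrier G0 \<Longrightarrow> e (s x) = x"
    and R: "R = {(d y, e y) | y. y \<in> carrier G1}"
  shows "R `` {\<one>\<^bsub>G0\<^esub>} \<lhd> G0" and "carrier G0 // R = rcosets\<^bsub>G0\<^esub> (R `` {\<one>\<^bsub>G0\<^esub>})"
proof -
  interpret d: group_hom G1 G0 d by (rule d)
  interpret e: group_hom G1 G0 e by (rule e)
  interpret s: group_hom G0 G1 s by (rule s)
  let ?H = "R `` {\<one>\<^bsub>G0\<^esub>}"
  have H: "?H = e ` kernel G1 G0 d"
    by (force simp: R kernel_def)
  have "subgroup ?H G0"
    unfolding H by (rule e.subgroup_img_is_subgroup[OF d.subgroup_kernel])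
  then show "?H \<lhd> G0"
  proof (rule d.H.normal_invI)
    fix x h assume x: "x \<in> carrier G0" and "h \<in> ?H"
    then obtain y where y: "y \<in> kernel G1 G0 d" "h = e y" unfolding H by blast
    \<comment> \<open>Conjugation by \<open>x\<close> lifts to conjugation by \<open>s x\<close>,
      which preserves the kernel of \<open>d\<close>.\<close>
    have "s x \<otimes>\<^bsub>G1\<^esub> y \<otimes>\<^bsub>G1\<^esub> inv\<^bsub>G1\<^esub> s x \<in> kernel G1 G0 d"
      using d.normal_kernel x y by (simp add: d.G.normal_inv_iff)
    moreover have "e (s x \<otimes>\<^bsub>G1\<^esub> y \<otimes>\<^bsub>G1\<^esub> inv\<^bsub>G1\<^esub> s x) = x \<otimes>\<^bsub>G0\<^esub> h \<otimes>\<^bsub>G0\<^esub> inv\<^bsub>G0\<^esub> x"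
      using x y by (simp add: kernel_def sect)
    ultimately show "x \<otimes>\<^bsub>G0\<^esub> h \<otimes>\<^bsub>G0\<^esub> inv\<^bsub>G0\<^esub> x \<in> ?H"
      unfolding H by (metis imageI)
  qed
  have coset: "R `` {x} = ?H #>\<^bsub>G0\<^esub> x" if x: "x \<in> carrier G0" for x
  proof (intro equalityI subsetI)
    fix x' assume "x' \<in> R `` {x}"
    then obtain y where y: "y \<in> carrier G1" "d y = x" "e y = x'" by (auto simp: R)
    \<comment> \<open>Dividing by \<open>s x\<close> on the right moves the pair
      \<open>(x, x')\<close> to a pair that starts at the unit.\<close>
    have "y \<otimes>\<^bsub>G1\<^esub> inv\<^bsub>G1\<^esub> s x \<in> kernel G1 G0 d"
      using x y by (simp add: kernel_def sect)
    moreover have "x' = e (y \<otimes>\<^bsub>G1\<^esub> inv\<^bsub>G1\<^esub> s x) \<otimes>\<^bsub>G0\<^esub> x"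
      using x y by (auto simp: sect d.H.m_assoc)
    ultimately show "x' \<in> ?H #>\<^bsub>G0\<^esub> x"
      unfolding H r_coset_def by blast
  next
    fix x' assume "x' \<in> ?H #>\<^bsub>G0\<^esub> x"
    then obtain y where y: "y \<in> carrier G1" "d y = \<one>\<^bsub>G0\<^esub>" "x' = e y \<otimes>\<^bsub>G0\<^esub> x"
      unfolding H r_coset_def by (auto simp: kernel_def)
    then have "y \<otimes>\<^bsub>G1\<^esub> s x \<in> carrier G1"
      "(x, x') = (d (y \<otimes>\<^bsub>G1\<^esub> s x), e (y \<otimes>\<^bsub>G1\<^esub> s x))"
      using x by (simp_all add: sect)
    then have "(x, x') \<in> R"
      unfolding R by blast
    then show "x' \<in> R `` {x}"
      by simp
  qed
  show "carrier G0 // R = rcosets\<^bsub>G0\<^esub> ?H"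
    unfolding quotient_def RCOSETS_def
    by (intro SUP_cong refl arg_cong[where f = "\<lambda>A. {A}"]) (rule coset)
qed

context simplicial_set
begin

lemma face_aut_degen:
  assumes "\<theta> \<in> ord_maps (Suc m) n" "i \<le> Suc m" "f \<in> carrier (aut_level X n)"
  shows "face (aut_sset X) (Suc m) i (act (aut_sset X) n \<theta> f) =
    act (aut_sset X) n (ord_comp \<theta> (coface (Suc m) i)) f"
  unfolding face_def using aut_act_comp[OF assms(1) coface_closed[of "Suc m" i]] assms by simp

text \<open>In dimension 0 every vertex is spherical and the condition on the faces below
  \<open>n\<close> is vacuous; only the two ends of a 1-simplex remain.\<close>

lemma sphere_rel_0_aut:
  "sphere_rel (aut_sset X) b 0 =
    {(face (aut_sset X) 1 0 y, face (aut_sset X) 1 1 y) | y. y \<in> carrier (aut_level X 1)}"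
  using group_hom.hom_closed[OF face_aut_hom[of 0 0]] group_hom.hom_closed[OF face_aut_hom[of 1 0]]
  by (auto simp: sphere_rel_def spheres_def)

text \<open>The degeneracy along \<open>[0, 0]\<close> is a common section of both faces of
  1-simplices. Components are thus cosets of a normal subgroup, on which \<open>set_mult\<close> is
  the product of the factor group.\<close>

lemma pi0_aut_eq:
  defines "H \<equiv> sphere_rel (aut_sset X) \<one>\<^bsub>aut_level X 0\<^esub> 0 `` {\<one>\<^bsub>aut_level X 0\<^esub>}"
  shows "H \<lhd> aut_level X 0" and "pi0_aut X = aut_level X 0 Mod H"
proof -
  have s: "[0, 0] \<in> ord_maps 1 0"
    by (simp add: ord_maps_def)
  have sect: "face (aut_sset X) 1 i (act (aut_sset X) 0 [0, 0] f) = f"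
    if "i \<le> 1" "f \<in> carrier (aut_level X 0)" for i f
    using face_aut_degen[of "[0, 0]" 0 0 i f] s that aut_act_id[of f 0 0]
    by (auto simp: ord_comp_def ord_list_simps le_Suc_eq)
  have d: "group_hom (aut_level X 1) (aut_level X 0) (face (aut_sset X) 1 i)" if "i \<le> 1" for i
    using face_aut_hom[of i 0] that by simp
  note cosets = graph_of_homs_cosets[OF d[of 0] d[of 1] act_aut_hom[OF s]
      sect[of 0] sect[of 1] sphere_rel_0_aut, simplified]
  show "H \<lhd> aut_level X 0"
    unfolding H_def by (rule cosets(1))
  show "pi0_aut X = aut_level X 0 Mod H"
    unfolding pi0_aut_def FactGroup_def H_def homotopy_set_def
    using cosets(2) by (simp add: spheres_def)
qed

lemma group_pi0_aut: "group (pi0_aut X)"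
  using pi0_aut_eq normal.factorgroup_is_group by metis

end

section \<open>Simplicial maps into partial monoids\<close>

text \<open>Lets a prism be the source \<open>Y\<close> in
  \<open>smaps_eq_on_edgesI\<close>.\<close>

lemma (in simplicial_set) simplicial_set_prism:
  "simplicial_set (sset_prod X (std_simplex n))"
proof
  fix p m k \<theta> assume "p \<in> simplices (sset_prod X (std_simplex n)) m" "\<theta> \<in> ord_maps k m"
  then show "act (sset_prod X (std_simplex n)) m \<theta> p \<in> simplices (sset_prod X (std_simplex n)) k"
    by (cases p) (auto simp: act_closed intro: ord_comp_closed)
next
  fix p m assume "p \<in> simplices (sset_prod X (std_simplex n)) m"
  then show "act (sset_prod X (std_simplex n)) m (ord_id m) p = p"
    by (cases p) (auto simp: act_id)
next
  fix p m k l \<theta> \<phi>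
  assume "p \<in> simplices (sset_prod X (std_simplex n)) m" "\<theta> \<in> ord_maps k m" "\<phi> \<in> ord_maps l k"
  then show "act (sset_prod X (std_simplex n)) m (ord_comp \<theta> \<phi>) p =
      act (sset_prod X (std_simplex n)) k \<phi> (act (sset_prod X (std_simplex n)) m \<theta> p)"
    by (cases p) (simp add: act_comp ord_comp_assoc)
qed

lemma ord_maps_edge: "i \<le> j \<Longrightarrow> j \<le> n \<Longrightarrow> [i, j] \<in> ord_maps (Suc 0) n"
  by (simp add: ord_maps_def)

lemma ord_maps_triangle: "i \<le> j \<Longrightarrow> j \<le> k \<Longrightarrow> k \<le> n \<Longrightarrow> [i, j, k] \<in> ord_maps 2 n"
  by (simp add: ord_maps_def)

lemma (in simplicial_set) act_edge:
  "\<lbrakk>x \<in> simplices X n; \<theta> \<in> ord_maps m n; i \<le> j; j \<le> m\<rbrakk>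
    \<Longrightarrow> act X m [i, j] (act X n \<theta> x) = act X n [\<theta> ! i, \<theta> ! j] x"
  using act_comp[of x n \<theta> m "[i, j]" 1] by (simp add: ord_maps_edge ord_comp_def)

lemma prism_edge:
  "\<lbrakk>F \<in> maps_from_prism X n Y; x \<in> simplices X k; \<sigma> \<in> ord_maps k n; i \<le> j; j \<le> k\<rbrakk>
    \<Longrightarrow> act Y k [i, j] (F k (x, \<sigma>)) = F 1 (act X k [i, j] x, [\<sigma> ! i, \<sigma> ! j])"
  by (simp add: prism_natural[where m = 1] ord_maps_edge ord_comp_def)

context partial_monoid
begin

lemma eq_on_spineI:
  assumes "x \<in> simplices M n" "y \<in> simplices M n"
    and "\<And>i. i < n \<Longrightarrow> act M n [i, Suc i] x = act M n [i, Suc i] y"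
  shows "x = y"
proof (cases "n = 0")
  case True
  then show ?thesis using assms unique_vertex by auto
next
  case False
  moreover have "spine M n x = spine M n y"
    using assms(3) by (simp add: spine_def)
  ultimately show ?thesis
    using spine_inj[of n] assms by (auto dest: inj_onD)
qed

text \<open>Naturality along the operators \<open>[i, Suc i]\<close> turns agreement on edges into
  agreement of spines in \<open>M\<close>, and spines are injective.\<close>

lemma smaps_eq_on_edgesI:
  assumes "simplicial_set Y" "f \<in> smaps Y M" "g \<in> smaps Y M"
    and "\<And>x. x \<in> simplices Y 1 \<Longrightarrow> f 1 x = g 1 x"
  shows "f = g"
proof (rule smaps_eqI[OF assms(2,3)])
  interpret Y: simplicial_set Y by fact
  fix n x assume x: "x \<in> simplices Y n"
  show "f n x = g n x"
  proof (rule eq_on_spineI)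
    fix i assume "i < n"
    then have "[i, Suc i] \<in> ord_maps 1 n" by (simp add: ord_maps_edge)
    with x assms show "act M n [i, Suc i] (f n x) = act M n [i, Suc i] (g n x)"
      by (simp add: Y.act_closed flip: smaps_natural[where m = 1])
  qed (use x assms in \<open>auto simp: smaps_closed\<close>)
qed

lemma prism_eq_on_edgesI:
  assumes "F \<in> maps_from_prism M n M" "G \<in> maps_from_prism M n M"
    and "\<And>x i j. \<lbrakk>x \<in> simplices M 1; i \<le> j; j \<le> n\<rbrakk> \<Longrightarrow> F 1 (x, [i, j]) = G 1 (x, [i, j])"
  shows "F = G"
  by (rule smaps_eq_on_edgesI[OF simplicial_set_prism assms(1,2)])
    (use assms(3) in \<open>auto simp: ord_maps_1[simplified]\<close>)

lemma triangle_eqI: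
  assumes "p \<in> simplices M 2" "q \<in> simplices M 2"
    and "act M 2 [0, 1] p = act M 2 [0, 1] q" "act M 2 [1, 2] p = act M 2 [1, 2] q"
  shows "p = q"
  by (rule eq_on_spineI[OF assms(1,2)]) (use assms(3,4) in \<open>auto simp: numeral_2_eq_2 less_Suc_eq\<close>)

lemma pmult_triangle:
  assumes "w \<in> simplices M 2"
  shows "pmult M (act M 2 [0, 1] w) (act M 2 [1, 2] w) = act M 2 [0, 2] w"
proof -
  have "(THE u. u \<in> simplices M 2 \<and> spine M 2 u = [act M 2 [0, 1] w, act M 2 [1, 2] w]) = w"
  proof (rule the_equality)
    show "w \<in> simplices M 2 \<and> spine M 2 w = [act M 2 [0, 1] w, act M 2 [1, 2] w]"
      using assms by (simp add: spine_def numeral_2_eq_2)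
  next
    fix u assume "u \<in> simplices M 2 \<and> spine M 2 u = [act M 2 [0, 1] w, act M 2 [1, 2] w]"
    then show "u = w"
      using assms by (intro triangle_eqI[of u w]) (simp_all add: spine_def numeral_2_eq_2)
  qed
  then show ?thesis
    by (simp add: pmult_def total_prod_def)
qed

text \<open>The operator \<open>[j, j]\<close> factors through the vertex \<open>[j]\<close>, and
  \<open>M\<close> has a single vertex.\<close>

lemma act_point:
  assumes "x \<in> simplices M n" "j \<le> n"
  shows "act M n [j, j] x = punit M"
proof -
  let ?v = "act M n [j] x"
  have j: "[j] \<in> ord_maps 0 n" using assms by (simp add: ord_maps_def)
  then have "?v \<in> simplices M 0" using assms by (simp add: act_closed)
  then have "(THE v. v \<in> simplices M 0) = ?v" using unique_vertex by (auto intro: the_equality)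
  moreover have "act M n [j, j] x = act M 0 [0, 0] ?v"
    using act_comp[of x n "[j]" 0 "[0, 0]" 1] assms j by (simp add: ord_comp_def ord_maps_def)
  ultimately show ?thesis by (simp add: punit_def)
qed

lemma punit_closed: "punit M \<in> simplices M 1"
proof -
  obtain v where v: "v \<in> simplices M 0" using unique_vertex by auto
  then show ?thesis
    using act_point[OF v, of 0] act_closed[OF v, of "[0, 0]" 1] by (simp add: ord_maps_def)
qed

lemma act_edge_id: "x \<in> simplices M 1 \<Longrightarrow> act M 1 [0, 1] x = x"
  using act_id[of x 1] by (simp add: ord_list_simps)

lemma smaps_punit:
  assumes "f \<in> smaps M M"
  shows "f 1 (punit M) = punit M"
proof -
  obtain v where v: "v \<in> simplices M 0" using unique_vertex by auto
  moreover have "[0, 0] \<in> ord_maps 1 0" by (simp add: ord_maps_def)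
  ultimately show ?thesis
    using act_point[of v 0 0] act_point[of "f 0 v" 0 0]
      smaps_natural[OF assms, of v 0 "[0, 0]" 1] smaps_closed[OF assms, of v 0] by simp
qed

text \<open>The triangle \<open>([x|1], [i, i, j])\<close> is one half of the square over
  \<open>x\<close> and \<open>[i, j]\<close>. Its image shows the diagonal
  \<open>F (x, [i, j])\<close> as the product of \<open>F (x, [i, i])\<close> and
  \<open>F (1, [i, j])\<close>.\<close>

lemma prism_triangle_right:
  assumes "F \<in> maps_from_prism M n M" "x \<in> simplices M 1" "i \<le> j" "j \<le> n"
  obtains p where "p \<in> simplices M 2" "act M 2 [0, 1] p = F 1 (x, [i, i])"
    "act M 2 [1, 2] p = F 1 (punit M, [i, j])" "act M 2 [0, 2] p = F 1 (x, [i, j])"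
proof
  let ?s = "act M 1 [0, 1, 1] x"
  have s: "?s \<in> simplices M 2" "act M 2 [0, 1] ?s = x" "act M 2 [0, 2] ?s = x"
    "act M 2 [1, 2] ?s = punit M"
    using assms(2) act_edge[of x 1 "[0, 1, 1]" 2] act_edge_id[OF assms(2)] act_point[of x 1 1]
    by (simp_all add: act_closed ord_maps_triangle)
  show "F 2 (?s, [i, i, j]) \<in> simplices M 2"
    using assms s by (simp add: prism_closed ord_maps_triangle)
  show "act M 2 [0, 1] (F 2 (?s, [i, i, j])) = F 1 (x, [i, i])"
    "act M 2 [1, 2] (F 2 (?s, [i, i, j])) = F 1 (punit M, [i, j])"
    "act M 2 [0, 2] (F 2 (?s, [i, i, j])) = F 1 (x, [i, j])"
    using prism_edge[OF assms(1) s(1), of "[i, i, j]"] assms s by (simp_all add: ord_maps_triangle)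
qed

text \<open>The other half of the square, \<open>([1|x], [i, j, j])\<close>, shows the same diagonal
  as the product of \<open>F (1, [i, j])\<close> and \<open>F (x, [j, j])\<close>.\<close>

lemma prism_triangle_left:
  assumes "F \<in> maps_from_prism M n M" "x \<in> simplices M 1" "i \<le> j" "j \<le> n"
  obtains p where "p \<in> simplices M 2" "act M 2 [0, 1] p = F 1 (punit M, [i, j])"
    "act M 2 [1, 2] p = F 1 (x, [j, j])" "act M 2 [0, 2] p = F 1 (x, [i, j])"
proof
  let ?s = "act M 1 [0, 0, 1] x"
  have s: "?s \<in> simplices M 2" "act M 2 [1, 2] ?s = x" "act M 2 [0, 2] ?s = x"
    "act M 2 [0, 1] ?s = punit M"
    using assms(2) act_edge[of x 1 "[0, 0, 1]" 2] act_edge_id[OF assms(2)] act_point[of x 1 0]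
    by (simp_all add: act_closed ord_maps_triangle)
  show "F 2 (?s, [i, j, j]) \<in> simplices M 2"
    using assms s by (simp add: prism_closed ord_maps_triangle)
  show "act M 2 [0, 1] (F 2 (?s, [i, j, j])) = F 1 (punit M, [i, j])"
    "act M 2 [1, 2] (F 2 (?s, [i, j, j])) = F 1 (x, [j, j])"
    "act M 2 [0, 2] (F 2 (?s, [i, j, j])) = F 1 (x, [i, j])"
    using prism_edge[OF assms(1) s(1), of "[i, j, j]"] assms s by (simp_all add: ord_maps_triangle)
qed

text \<open>The triangle \<open>([x|1], [0, 1, 2])\<close> is sent to a simplex of \<open>M\<close>
  whose spine lies over \<open>[0, 1]\<close> and \<open>[1, 2]\<close>. The spine determines that
  simplex, hence also its long edge \<open>F (x, [0, 2])\<close>.\<close>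

lemma prism_inner_horn_eqI:
  assumes F: "F \<in> maps_from_prism M 2 M" and G: "G \<in> maps_from_prism M 2 M"
    and eq: "\<And>x i j. \<lbrakk>x \<in> simplices M 1; i \<le> j; j \<le> 2; (i, j) \<noteq> (0, 2)\<rbrakk>
      \<Longrightarrow> F 1 (x, [i, j]) = G 1 (x, [i, j])"
  shows "F = G"
proof (rule prism_eq_on_edgesI[OF F G])
  fix x i j assume x: "x \<in> simplices M 1" and ij: "i \<le> j" "j \<le> (2::nat)"
  let ?s = "act M 1 [0, 1, 1] x"
  have t: "[0, 1, 2] \<in> ord_maps 2 2" by (simp add: ord_maps_triangle)
  have s: "?s \<in> simplices M 2" "act M 2 [0, 2] ?s = x"
    using x act_edge[of x 1 "[0, 1, 1]" 2] act_edge_id[OF x]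
    by (simp_all add: act_closed ord_maps_triangle)
  have "F 2 (?s, [0, 1, 2]) = G 2 (?s, [0, 1, 2])"
    by (rule triangle_eqI)
      (use s t F G in \<open>simp_all add: prism_closed prism_edge[of F M 2 M] prism_edge[of G M 2 M]
        eq[simplified] act_closed[where m = "Suc 0"] ord_maps_edge\<close>)
  then have "F 1 (x, [0, 2]) = G 1 (x, [0, 2])"
    using prism_edge[OF F s(1) t, of 0 2] prism_edge[OF G s(1) t, of 0 2] s by simp
  then show "F 1 (x, [i, j]) = G 1 (x, [i, j])"
    using eq x ij by (cases "(i, j) = (0, 2)") auto
qed

end

section \<open>Cancellation in partial groups\<close>

lemma ord_op_closed:
  assumes "\<theta> \<in> ord_maps m n"
  shows "ord_op n \<theta> \<in> ord_maps m n"
proof -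
  have "sorted_wrt (\<ge>) (rev \<theta>)" using assms by (simp add: ord_maps_def sorted_wrt_rev)
  then have "sorted (map (\<lambda>j. n - j) (rev \<theta>))"
    unfolding sorted_map by (rule sorted_wrt_mono_rel[rotated]) auto
  then show ?thesis
    using assms by (auto simp: ord_maps_def ord_op_def)
qed

lemma ord_op_nth:
  "\<lbrakk>\<theta> \<in> ord_maps m n; i \<le> m\<rbrakk> \<Longrightarrow> ord_op n \<theta> ! i = n - \<theta> ! (m - i)"
  by (simp add: ord_op_def ord_maps_def rev_nth)

context partial_monoid
begin

context
  fixes \<nu> assumes inversion: "is_inversion M \<nu>"
begin

lemma inversion_closed: "x \<in> simplices M n \<Longrightarrow> \<nu> n x \<in> simplices M n"
  using inversion smaps_closed[of \<nu> M "sset_op M"] by (simp add: is_inversion_def sset_op_def)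

lemma inversion_involution: "x \<in> simplices M n \<Longrightarrow> \<nu> n (\<nu> n x) = x"
  using inversion by (simp add: is_inversion_def)

lemma inversion_edge:
  assumes "x \<in> simplices M n" "i \<le> j" "j \<le> n"
  shows "\<nu> 1 (act M n [i, j] x) = act M n [n - j, n - i] (\<nu> n x)"
  using assms inversion smaps_natural[of \<nu> M "sset_op M" x n "[i, j]" 1]
  by (simp add: is_inversion_def sset_op_def ord_op_def ord_maps_edge)

lemma inversion_triangle:
  assumes "x \<in> simplices M 1"
  obtains w where "w \<in> simplices M 2" "act M 2 [0, 1] w = \<nu> 1 x"
    "act M 2 [1, 2] w = x" "act M 2 [0, 2] w = punit M"
proof -
  obtain w where "w \<in> simplices M (2 * 1)"
    "spine M (2 * 1) w = spine M 1 (\<nu> 1 x) @ spine M 1 x" "total_prod M (2 * 1) w = punit M"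
    using inversion assms unfolding is_inversion_def by blast
  moreover have "act M 1 [0, 1] (\<nu> 1 x) = \<nu> 1 x" "act M 1 [0, 1] x = x"
    using act_edge_id[OF inversion_closed[OF assms]] act_edge_id[OF assms] by auto
  ultimately show ?thesis
    using that by (simp add: spine_def total_prod_def numeral_2_eq_2)
qed

text \<open>For \<open>p = [a|b]\<close> this is the rule that \<open>ab\<close> times the inverse
  of \<open>b\<close> is \<open>a\<close>; the point is that the simplex \<open>[ab|\<nu> b]\<close>
  exists. It is found as a face of a 4-simplex with spine
  \<open>a, b, \<nu> b, \<nu> a\<close>.\<close>

lemma inversion_right_cancel:
  assumes p: "p \<in> simplices M 2"
  obtains q where "q \<in> simplices M 2" "act M 2 [0, 1] q = act M 2 [0, 2] p"
    "act M 2 [1, 2] q = \<nu> 1 (act M 2 [1, 2] p)" "act M 2 [0, 2] q = act M 2 [0, 1] p"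
proof -
  let ?a = "act M 2 [0, 1] p" and ?b = "act M 2 [1, 2] p"
  have ab: "?a \<in> simplices M 1" "?b \<in> simplices M 1"
    using p by (auto simp: act_closed ord_maps_edge)
  \<comment> \<open>The inversion axiom is applied to \<open>\<nu> 2 p\<close> and not to
    \<open>p\<close>: then \<open>\<nu> 2 (\<nu> 2 p) = p\<close> comes first in the spine.\<close>
  obtain w where w: "w \<in> simplices M 4"
    and spine: "spine M 4 w = spine M 2 (\<nu> 2 (\<nu> 2 p)) @ spine M 2 (\<nu> 2 p)"
    using inversion inversion_closed[OF p] unfolding is_inversion_def
    by (metis mult_2 numeral_Bit0 one_le_numeral)
  have edges: "act M 4 [0, 1] w = ?a" "act M 4 [1, 2] w = ?b" "act M 4 [2, 3] w = \<nu> 1 ?b"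
    using spine inversion_edge[OF p, of 1 2] p
    by (simp_all add: spine_def inversion_involution upt_rec eval_nat_numeral)
  have sub: "[0, 1, 2] \<in> ord_maps 2 4" "[1, 2, 3] \<in> ord_maps 2 4" "[0, 1, 3] \<in> ord_maps 2 4"
    "[0, 2, 3] \<in> ord_maps 2 4"
    by (simp_all add: ord_maps_triangle)
  note sub_closed = sub[THEN act_closed[OF w]] and sub_edge = sub[THEN act_edge[OF w]]
  have "act M 4 [0, 1, 2] w = p"
    by (rule triangle_eqI) (use sub_closed p edges sub_edge in simp_all)
  then have prod: "act M 4 [0, 2] w = act M 2 [0, 2] p"
    using sub_edge(1)[of 0 2] by simp
  obtain w' where w': "w' \<in> simplices M 2" "act M 2 [0, 1] w' = \<nu> 1 (\<nu> 1 ?b)"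
    "act M 2 [1, 2] w' = \<nu> 1 ?b" "act M 2 [0, 2] w' = punit M"
    using inversion_triangle[OF inversion_closed[OF ab(2)]] .
  \<comment> \<open>The face \<open>[1, 2, 3]\<close> has spine \<open>b, \<nu> b\<close>. As
    \<open>b = \<nu> (\<nu> b)\<close>, it is the triangle that the inversion axiom gives for
    \<open>\<nu> b\<close>, and its product is 1.\<close>
  have "act M 4 [1, 2, 3] w = w'"
    by (rule triangle_eqI) (use sub_closed w' edges sub_edge ab in \<open>simp_all add: inversion_involution\<close>)
  then have unit: "act M 4 [1, 3] w = punit M"
    using sub_edge(2)[of 0 2] w' by simp
  \<comment> \<open>Now the face \<open>[0, 1, 3]\<close> has spine \<open>a, 1\<close>, so it is
    the degenerate triangle \<open>?s\<close> and the edge \<open>[0, 3]\<close> is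
    \<open>a\<close>. The face \<open>[0, 2, 3]\<close> is then the required
    \<open>q\<close>.\<close>
  let ?s = "act M 1 [0, 1, 1] ?a"
  have s: "?s \<in> simplices M 2" "act M 2 [0, 1] ?s = ?a" "act M 2 [0, 2] ?s = ?a"
    "act M 2 [1, 2] ?s = punit M"
    using act_edge[OF ab(1), of "[0, 1, 1]" 2] act_edge_id[OF ab(1)] act_point[OF ab(1), of 1] ab(1)
    by (simp_all add: act_closed ord_maps_triangle)
  have "act M 4 [0, 1, 3] w = ?s"
    by (rule triangle_eqI) (use sub_closed s edges sub_edge unit in simp_all)
  then have "act M 4 [0, 3] w = ?a"
    using sub_edge(3)[of 0 2] s by simp
  then show ?thesis
    using that[OF sub_closed(4)] sub_edge(4) prod edges by simp
qed

text \<open>Both \<open>[f (\<nu> x)|f x]\<close> and \<open>[\<nu> (f x)|f x]\<close> have product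
  1. Cancelling \<open>f x\<close> on the right exhibits both first edges as the product of the one
  simplex \<open>[1|\<nu> (f x)]\<close>.\<close>

lemma smaps_inversion:
  assumes "f \<in> smaps M M" "x \<in> simplices M 1"
  shows "f 1 (\<nu> 1 x) = \<nu> 1 (f 1 x)"
proof -
  obtain w where w: "w \<in> simplices M 2" "act M 2 [0, 1] w = \<nu> 1 x"
    "act M 2 [1, 2] w = x" "act M 2 [0, 2] w = punit M"
    using inversion_triangle[OF assms(2)] .
  have fw: "f 2 w \<in> simplices M 2" and fw_edge:
    "\<And>i j. i \<le> j \<Longrightarrow> j \<le> 2 \<Longrightarrow> act M 2 [i, j] (f 2 w) = f 1 (act M 2 [i, j] w)"
    using smaps_closed[OF assms(1) w(1)] smaps_natural[OF assms(1) w(1), where m = 1]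
    by (simp_all add: ord_maps_edge)
  obtain w' where w': "w' \<in> simplices M 2" "act M 2 [0, 1] w' = \<nu> 1 (f 1 x)"
    "act M 2 [1, 2] w' = f 1 x" "act M 2 [0, 2] w' = punit M"
    using inversion_triangle[OF smaps_closed[OF assms]] .
  obtain q where q: "q \<in> simplices M 2" "act M 2 [0, 1] q = punit M"
    "act M 2 [1, 2] q = \<nu> 1 (f 1 x)" "act M 2 [0, 2] q = f 1 (\<nu> 1 x)"
    using inversion_right_cancel[OF fw] fw_edge w smaps_punit[OF assms(1)] by auto
  obtain q' where q': "q' \<in> simplices M 2" "act M 2 [0, 1] q' = punit M"
    "act M 2 [1, 2] q' = \<nu> 1 (f 1 x)" "act M 2 [0, 2] q' = \<nu> 1 (f 1 x)"
    using inversion_right_cancel[OF w'(1)] w' by auto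
  have "q = q'" by (rule triangle_eqI) (use q q' in auto)
  then show ?thesis using q q' by simp
qed

end

end

text \<open>In a triangle \<open>[a|b]\<close> the edge \<open>a\<close> is the product of
  \<open>[ab|\<nu> b]\<close>, and that simplex is determined by its spine.\<close>

lemma (in partial_group) right_cancel:
  assumes "p \<in> simplices M 2" "q \<in> simplices M 2"
    and "act M 2 [1, 2] p = act M 2 [1, 2] q" "act M 2 [0, 2] p = act M 2 [0, 2] q"
  shows "act M 2 [0, 1] p = act M 2 [0, 1] q"
proof -
  obtain \<nu> where \<nu>: "is_inversion M \<nu>" using inversion_exists by auto
  obtain p' where p': "p' \<in> simplices M 2" "act M 2 [0, 1] p' = act M 2 [0, 2] p"
    "act M 2 [1, 2] p' = \<nu> 1 (act M 2 [1, 2] p)" "act M 2 [0, 2] p' = act M 2 [0, 1] p"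
    using inversion_right_cancel[OF \<nu> assms(1)] .
  obtain q' where q': "q' \<in> simplices M 2" "act M 2 [0, 1] q' = act M 2 [0, 2] q"
    "act M 2 [1, 2] q' = \<nu> 1 (act M 2 [1, 2] q)" "act M 2 [0, 2] q' = act M 2 [0, 1] q"
    using inversion_right_cancel[OF \<nu> assms(2)] .
  have "p' = q'" by (rule triangle_eqI) (use p' q' assms in auto)
  then show ?thesis using p' q' by simp
qed

section \<open>Invertibility of homotopies between automorphisms\<close>

lemma AutE:
  assumes "f \<in> carrier (Aut_group X)"
  obtains g where "f \<in> smaps X X" "g \<in> smaps X X"
    "\<And>n x. x \<in> simplices X n \<Longrightarrow> g n (f n x) = x" "\<And>n x. x \<in> simplices X n \<Longrightarrow> f n (g n x) = x"
proof -
  from assms obtain g where g: "f \<in> smaps X X" "g \<in> smaps X X"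
    "smap_comp X g f = smap_id X" "smap_comp X f g = smap_id X"
    by (auto simp: Aut_group_def End_monoid_def units_of_def Units_def)
  have "smap_comp X g f n x = x" "smap_comp X f g n x = x" if "x \<in> simplices X n" for n x
    using that g by (simp_all add: smap_id_def)
  then show ?thesis
    using that g by (simp add: smap_comp_def compose_def)
qed

text \<open>The hypothesis makes \<open>F~\<close> bijective in every dimension, and the
  dimensionwise inverse of a simplicial map is again simplicial. Thus invertibility can be tested
  one fibre at a time.\<close>

lemma (in simplicial_set) aut_level_if_bij:
  assumes F: "F \<in> maps_from_prism X n X"
    and bij: "\<And>k \<sigma>. \<sigma> \<in> ord_maps k n \<Longrightarrow> bij_betw (\<lambda>x. F k (x, \<sigma>)) (simplices X k) (simplices X k)"
  shows "F \<in> carrier (aut_level X n)"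
proof -
  define G where "G k = (\<lambda>p \<in> simplices X k \<times> ord_maps k n.
    inv_into (simplices X k) (\<lambda>x. F k (x, snd p)) (fst p))" for k
  have G: "G k (x, \<sigma>) \<in> simplices X k" "F k (G k (x, \<sigma>), \<sigma>) = x" "G k (F k (x, \<sigma>), \<sigma>) = x"
    if "x \<in> simplices X k" "\<sigma> \<in> ord_maps k n" for k x \<sigma>
    using that bij[OF that(2)] bij_betw_inv_into_right[OF bij[OF that(2)] that(1)]
      bij_betw_inv_into_left[OF bij[OF that(2)] that(1)]
      bij_betw_apply[OF bij_betw_inv_into[OF bij[OF that(2)]] that(1)] prism_closed[OF F that]
    by (simp_all add: G_def)
  have G_smap: "G \<in> maps_from_prism X n X"
  proof (rule prismI)
    fix k m x \<sigma> \<theta>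
    assume x: "x \<in> simplices X k" and \<sigma>: "\<sigma> \<in> ord_maps k n" and \<theta>: "\<theta> \<in> ord_maps m k"
    have "F m (act X k \<theta> (G k (x, \<sigma>)), ord_comp \<sigma> \<theta>) = act X k \<theta> x"
      using prism_natural[OF F G(1)[OF x \<sigma>] \<sigma> \<theta>] G(2)[OF x \<sigma>] by simp
    then show "G m (act X k \<theta> x, ord_comp \<sigma> \<theta>) = act X k \<theta> (G k (x, \<sigma>))"
      using G(3)[OF act_closed[OF G(1)[OF x \<sigma>] \<theta>] ord_comp_closed[OF \<sigma> \<theta>]] by simp
  next
    show "G k \<in> extensional (simplices X k \<times> ord_maps k n)" for k by (simp add: G_def)
  qed (rule G)
  have "G \<otimes>\<^bsub>Map_monoid X n\<^esub> F = \<one>\<^bsub>Map_monoid X n\<^esub>" "F \<otimes>\<^bsub>Map_monoid X n\<^esub> G = \<one>\<^bsub>Map_monoid X n\<^esub>"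
    by (rule prism_eqI[of _ X n X];
        use F G_smap in \<open>simp add: Map_mult_closed Map_one_closed G\<close>)+
  then show ?thesis
    using F G_smap by (auto simp: aut_level_def units_of_carrier Units_def)
qed

text \<open>Bridges the gap between \<open>aut_htpy_rel\<close>, which admits all homotopies, and
  \<open>aut_sset\<close>, whose 1-simplices are invertible. With ends \<open>f\<close>,
  \<open>g\<close> and \<open>\<eta> = F (1, [0, 1])\<close>, the edge \<open>F (x, [0, 1])\<close>
  is the product of \<open>f x\<close> and \<open>\<eta>\<close> and also of \<open>\<eta>\<close>
  and \<open>g x\<close>. The first form gives injectivity by right cancellation; inverting the
  second yields preimages.\<close>

lemma (in partial_group) homotopy_invertible:
  assumes F: "F \<in> maps_from_prism M 1 M"
    and end0: "smap_end M F 0 \<in> carrier (Aut_group M)"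
    and end1: "smap_end M F 1 \<in> carrier (Aut_group M)"
  shows "F \<in> carrier (aut_level M 1)"
proof (rule aut_level_if_bij[OF F])
  obtain \<nu> where \<nu>: "is_inversion M \<nu>" using inversion_exists by auto
  let ?f = "smap_end M F 0" and ?g = "smap_end M F 1"
  obtain f' where f: "?f \<in> smaps M M" and f': "f' \<in> smaps M M"
    and f'f: "\<And>n x. x \<in> simplices M n \<Longrightarrow> f' n (?f n x) = x"
    and ff': "\<And>n x. x \<in> simplices M n \<Longrightarrow> ?f n (f' n x) = x"
    using AutE[OF end0] by metis
  obtain g' where g: "?g \<in> smaps M M" and g': "g' \<in> smaps M M"
    and g'g: "\<And>n x. x \<in> simplices M n \<Longrightarrow> g' n (?g n x) = x"
    and gg': "\<And>n x. x \<in> simplices M n \<Longrightarrow> ?g n (g' n x) = x"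
    using AutE[OF end1] by metis
  have F0: "F 1 (x, [0, 0]) = ?f 1 x" and F1: "F 1 (x, [1, 1]) = ?g 1 x" if "x \<in> simplices M 1" for x
    using that by (simp_all add: smap_end_def ord_const_def)
  note closed = smaps_closed[OF f'] smaps_closed[OF g'] smaps_closed[OF f] smaps_closed[OF g]
    inversion_closed[OF \<nu>]
  let ?\<eta> = "F 1 (punit M, [0, 1])"
  have inj_edge: "x = y" if x: "x \<in> simplices M 1" and y: "y \<in> simplices M 1"
    and eq: "F 1 (x, [i, j]) = F 1 (y, [i, j])" and ij: "i \<le> j" "j \<le> 1" for x y i j
  proof -
    consider "i = 0" "j = 0" | "i = 1" "j = 1" | "i = 0" "j = 1" using ij by linarith
    then show ?thesis
    proof cases
      case 1
      then show ?thesis using x y eq F0 f'f by metis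
    next
      case 2
      then show ?thesis using x y eq F1 g'g by metis
    next
      case 3
      obtain p where p: "p \<in> simplices M 2" "act M 2 [0, 1] p = F 1 (x, [0, 0])"
        "act M 2 [1, 2] p = ?\<eta>" "act M 2 [0, 2] p = F 1 (x, [0, 1])"
        using prism_triangle_right[OF F x, of 0 1] by auto
      obtain q where q: "q \<in> simplices M 2" "act M 2 [0, 1] q = F 1 (y, [0, 0])"
        "act M 2 [1, 2] q = ?\<eta>" "act M 2 [0, 2] q = F 1 (y, [0, 1])"
        using prism_triangle_right[OF F y, of 0 1] by auto
      have "?f 1 x = ?f 1 y"
        using right_cancel[OF p(1) q(1)] p q x y eq 3 F0 by simp
      then show ?thesis using f'f x y by metis
    qed
  qed
  \<comment> \<open>On edges, \<open>u = f\<inverse> (\<nu> (F (g\<inverse> (\<nu> w), \<sigma>\<^sup>o\<^sup>p)))\<close> solves \<open>F (u, \<sigma>) = w\<close>; since \<open>F\<close> is simplicial,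
    the same formula works in every dimension.\<close>
  have solve_edge: "F 1 (f' 1 (\<nu> 1 (F 1 (g' 1 (\<nu> 1 x), [1 - j, 1 - i]))), [i, j]) = x"
    if x: "x \<in> simplices M 1" and ij: "i \<le> j" "j \<le> 1" for x i j
  proof -
    let ?x = "g' 1 (\<nu> 1 x)"
    have x': "?x \<in> simplices M 1" using closed x by blast
    consider "i = 0" "j = 0" | "i = 1" "j = 1" | "i = 0" "j = 1" using ij by linarith
    then show ?thesis
    proof cases
      case 1
      have "F 1 (?x, [1, 1]) = \<nu> 1 x" using F1[OF x'] gg' closed x by simp
      moreover have "F 1 (f' 1 x, [0, 0]) = x" using F0 ff' closed(1)[OF x] x by simp
      ultimately show ?thesis using 1 inversion_involution[OF \<nu> x] by simp
    next
      case 2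
      \<comment> \<open>Here the formula collapses to \<open>g' 1 x\<close>, because simplicial maps
        commute with \<open>\<nu>\<close>, so that the two inversions cancel and \<open>f'\<close>
        undoes \<open>?f\<close>.\<close>
      have "\<nu> 1 (?f 1 ?x) = ?f 1 (g' 1 (\<nu> 1 (\<nu> 1 x)))"
        using smaps_inversion[OF \<nu> f, of ?x] smaps_inversion[OF \<nu> g', of "\<nu> 1 x"] closed x by simp
      then have "f' 1 (\<nu> 1 (F 1 (?x, [0, 0]))) = g' 1 x"
        using F0[OF x'] f'f closed x inversion_involution[OF \<nu> x] by simp
      moreover have "F 1 (g' 1 x, [1, 1]) = x" using F1 gg' closed(2)[OF x] x by simp
      ultimately show ?thesis using 2 by simp
    next
      case 3
      \<comment> \<open>Here \<open>r = [\<eta>|\<nu> x]\<close>, so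
        \<open>\<nu> 2 r = [x|\<nu> \<eta>]\<close>. Cancelling \<open>\<nu> \<eta>\<close> on the
        right gives a triangle \<open>q = [y|\<eta>]\<close> with product \<open>x\<close>, and
        \<open>?u\<close> below is the element that \<open>?f\<close> sends to
        \<open>y\<close>.\<close>
      obtain r where r: "r \<in> simplices M 2" "act M 2 [0, 1] r = ?\<eta>"
        "act M 2 [1, 2] r = F 1 (?x, [1, 1])" "act M 2 [0, 2] r = F 1 (?x, [0, 1])"
        using prism_triangle_left[OF F x', of 0 1] by auto
      have \<nu>r: "\<nu> 2 r \<in> simplices M 2" "act M 2 [0, 1] (\<nu> 2 r) = x"
        "act M 2 [1, 2] (\<nu> 2 r) = \<nu> 1 ?\<eta>" "act M 2 [0, 2] (\<nu> 2 r) = \<nu> 1 (F 1 (?x, [0, 1]))"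
        using inversion_edge[OF \<nu> r(1), of 1 2] inversion_edge[OF \<nu> r(1), of 0 1]
          inversion_edge[OF \<nu> r(1), of 0 2] r F1[OF x'] gg'[of "\<nu> 1 x" 1] closed x
          inversion_involution[OF \<nu> x]
        by (simp_all add: numeral_2_eq_2)
      have \<eta>: "?\<eta> \<in> simplices M 1"
        using prism_closed[OF F punit_closed] by (simp add: ord_maps_edge)
      obtain q where q: "q \<in> simplices M 2" "act M 2 [0, 1] q = \<nu> 1 (F 1 (?x, [0, 1]))"
        "act M 2 [1, 2] q = ?\<eta>" "act M 2 [0, 2] q = x"
        using inversion_right_cancel[OF \<nu> \<nu>r(1)] \<nu>r inversion_involution[OF \<nu> \<eta>] by metis
      let ?u = "f' 1 (\<nu> 1 (F 1 (?x, [0, 1])))"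
      have y: "\<nu> 1 (F 1 (?x, [0, 1])) \<in> simplices M 1"
        using q(1) unfolding q(2)[symmetric] by (simp add: act_closed ord_maps_edge)
      then have u: "?u \<in> simplices M 1" using closed by blast
      obtain q' where q': "q' \<in> simplices M 2" "act M 2 [0, 1] q' = F 1 (?u, [0, 0])"
        "act M 2 [1, 2] q' = ?\<eta>" "act M 2 [0, 2] q' = F 1 (?u, [0, 1])"
        using prism_triangle_right[OF F u, of 0 1] by auto
      have "q' = q" by (rule triangle_eqI) (use q q' F0 u ff' y in auto)
      then show ?thesis using q q' 3 by simp
    qed
  qed
  fix k \<sigma> assume \<sigma>: "\<sigma> \<in> ord_maps k 1"
  then have nth_mono: "\<sigma> ! i \<le> \<sigma> ! Suc i" "\<sigma> ! Suc i \<le> 1" if "i < k" for i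
    using that ord_maps_nth[OF \<sigma>, of i "Suc i"] by simp_all
  have edge_closed: "act M k [i, Suc i] x \<in> simplices M 1" if "x \<in> simplices M k" "i < k" for x i
    using that by (simp add: act_closed ord_maps_edge)
  show "bij_betw (\<lambda>x. F k (x, \<sigma>)) (simplices M k) (simplices M k)"
  proof (rule bij_betw_imageI)
    show "inj_on (\<lambda>x. F k (x, \<sigma>)) (simplices M k)"
    proof (rule inj_onI, rule eq_on_spineI)
      fix x y i
      assume x: "x \<in> simplices M k" and y: "y \<in> simplices M k"
        and eq: "F k (x, \<sigma>) = F k (y, \<sigma>)" and i: "i < k"
      have "F 1 (act M k [i, Suc i] x, [\<sigma> ! i, \<sigma> ! Suc i]) =
          F 1 (act M k [i, Suc i] y, [\<sigma> ! i, \<sigma> ! Suc i])"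
        using prism_edge[OF F x \<sigma>, of i "Suc i"] prism_edge[OF F y \<sigma>, of i "Suc i"] eq i by simp
      then show "act M k [i, Suc i] x = act M k [i, Suc i] y"
        by (rule inj_edge[OF edge_closed[OF x i] edge_closed[OF y i] _ nth_mono[OF i]])
    qed
    have "w \<in> (\<lambda>x. F k (x, \<sigma>)) ` simplices M k" if w: "w \<in> simplices M k" for w
    proof
      let ?\<tau> = "ord_op 1 \<sigma>"
      let ?v = "g' k (\<nu> k w)"
      let ?z = "F k (?v, ?\<tau>)"
      let ?u = "f' k (\<nu> k ?z)"
      have \<tau>: "?\<tau> \<in> ord_maps k 1" using \<sigma> by (rule ord_op_closed)
      have v: "?v \<in> simplices M k" using smaps_closed[OF g' inversion_closed[OF \<nu> w]] .
      have z: "?z \<in> simplices M k" using prism_closed[OF F v \<tau>] .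
      show u: "?u \<in> simplices M k" using smaps_closed[OF f' inversion_closed[OF \<nu> z]] .
      show "w = F k (?u, \<sigma>)"
      proof (rule eq_on_spineI[OF w prism_closed[OF F u \<sigma>]])
        fix i assume i: "i < k"
        \<comment> \<open>Inversion reverses vertices: the edge \<open>[i, Suc i]\<close> of
          \<open>?u\<close> comes from the edge \<open>[a, b]\<close> of \<open>?z\<close>, on which
          \<open>?\<tau>\<close> takes the values \<open>1 - \<sigma> ! Suc i\<close> and
          \<open>1 - \<sigma> ! i\<close>. This is the shape required by
          \<open>solve_edge\<close>.\<close>
        obtain a b where ab: "a = k - Suc i" "b = k - i" by simp
        then have ij: "a \<le> b" "b \<le> k" "k - b = i" "k - a = Suc i" using i by auto
        have "act M k [a, b] ?v = g' 1 (act M k [a, b] (\<nu> k w))"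
          using smaps_natural[OF g' inversion_closed[OF \<nu> w] ord_maps_edge[OF ij(1,2)]] by simp
        also have "act M k [a, b] (\<nu> k w) = \<nu> 1 (act M k [i, Suc i] w)"
          using inversion_edge[OF \<nu> w, of i "Suc i"] i by (simp add: ab)
        finally have "act M k [a, b] ?z =
            F 1 (g' 1 (\<nu> 1 (act M k [i, Suc i] w)), [1 - \<sigma> ! Suc i, 1 - \<sigma> ! i])"
          using prism_edge[OF F v \<tau> ij(1,2)] ord_op_nth[OF \<sigma>, of a] ord_op_nth[OF \<sigma>, of b] ij i by simp
        moreover have "act M k [i, Suc i] ?u = f' 1 (act M k [i, Suc i] (\<nu> k ?z))"
          using smaps_natural[OF f', of "\<nu> k ?z" k "[i, Suc i]" 1] i inversion_closed[OF \<nu> z]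
          by (simp add: ord_maps_edge)
        moreover have "act M k [i, Suc i] (\<nu> k ?z) = \<nu> 1 (act M k [a, b] ?z)"
          using inversion_edge[OF \<nu> z ij(1,2)] ij by simp
        ultimately have "act M k [i, Suc i] ?u =
            f' 1 (\<nu> 1 (F 1 (g' 1 (\<nu> 1 (act M k [i, Suc i] w)), [1 - \<sigma> ! Suc i, 1 - \<sigma> ! i])))"
          by simp
        then show "act M k [i, Suc i] w = act M k [i, Suc i] (F k (?u, \<sigma>))"
          using prism_edge[OF F u \<sigma>, of i "Suc i"] i
            solve_edge[OF edge_closed[OF w i] nth_mono[OF i]] by simp
      qed
    qed
    then show "(\<lambda>x. F k (x, \<sigma>)) ` simplices M k = simplices M k"
      using prism_closed[OF F _ \<sigma>] by auto
  qed
qed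

section \<open>Comparison with the homotopy groups\<close>

lemma aut_levelD: "F \<in> carrier (aut_level X n) \<Longrightarrow> F \<in> maps_from_prism X n X"
  by (auto simp: aut_level_def units_of_carrier Units_def)

lemma aut_level_mult [simp]: "mult (aut_level X n) = mult (Map_monoid X n)"
  by (simp add: aut_level_def units_of_mult)

lemma aut_level_one [simp]: "\<one>\<^bsub>aut_level X n\<^esub> = \<one>\<^bsub>Map_monoid X n\<^esub>"
  by (simp add: aut_level_def units_of_one)

text \<open>\<open>Out_group\<close>, \<open>center_group\<close> and \<open>pi_aut 1\<close> are
  bare records; their group laws are transported along isomorphisms from known groups.\<close>

lemma group_of_iso:
  assumes "group G" "h \<in> iso G H" "h \<one>\<^bsub>G\<^esub> = \<one>\<^bsub>H\<^esub>"
  shows "group H"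
  using group.iso_imp_img_group[OF assms(1,2)] unfolding assms(3) by simp

text \<open>Inverses move along \<open>h\<close> in both directions. Since \<open>H\<close> is an
  arbitrary record and \<open>iso\<close> speaks of products only, preservation of the unit is a
  separate assumption.\<close>

lemma iso_units_of:
  assumes "monoid G" and h: "h \<in> iso G H" and one: "h \<one>\<^bsub>G\<^esub> = \<one>\<^bsub>H\<^esub>"
  shows "h \<in> iso (units_of G) (units_of H)"
proof -
  interpret monoid G by fact
  have bij: "bij_betw h (carrier G) (carrier H)"
    and mult: "\<And>x y. x \<in> carrier G \<Longrightarrow> y \<in> carrier G \<Longrightarrow> h (x \<otimes>\<^bsub>G\<^esub> y) = h x \<otimes>\<^bsub>H\<^esub> h y"
    using h by (auto simp: iso_def hom_def)
  have closed: "h x \<in> carrier H" if "x \<in> carrier G" for x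
    using bij that by (rule bij_betw_apply)
  have "h ` Units G = Units H"
  proof (intro equalityI subsetI)
    fix y assume "y \<in> h ` Units G"
    then obtain x x' where x: "x \<in> carrier G" "x' \<in> carrier G" "y = h x"
      "x' \<otimes>\<^bsub>G\<^esub> x = \<one>\<^bsub>G\<^esub>" "x \<otimes>\<^bsub>G\<^esub> x' = \<one>\<^bsub>G\<^esub>"
      by (auto simp: Units_def)
    then have "h x' \<otimes>\<^bsub>H\<^esub> y = \<one>\<^bsub>H\<^esub>" "y \<otimes>\<^bsub>H\<^esub> h x' = \<one>\<^bsub>H\<^esub>"
      using mult one by metis+
    then show "y \<in> Units H"
      using x closed unfolding Units_def by auto
  next
    fix y assume "y \<in> Units H"
    then obtain y' where y: "y \<in> carrier H" "y' \<in> carrier H"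
      "y' \<otimes>\<^bsub>H\<^esub> y = \<one>\<^bsub>H\<^esub>" "y \<otimes>\<^bsub>H\<^esub> y' = \<one>\<^bsub>H\<^esub>"
      by (auto simp: Units_def)
    then obtain x x' where x: "x \<in> carrier G" "x' \<in> carrier G" "y = h x" "y' = h x'"
      using bij_betw_imp_surj_on[OF bij] by blast
    then have "h (x' \<otimes>\<^bsub>G\<^esub> x) = h \<one>\<^bsub>G\<^esub>" "h (x \<otimes>\<^bsub>G\<^esub> x') = h \<one>\<^bsub>G\<^esub>"
      using mult one y by auto
    then have "x' \<otimes>\<^bsub>G\<^esub> x = \<one>\<^bsub>G\<^esub>" "x \<otimes>\<^bsub>G\<^esub> x' = \<one>\<^bsub>G\<^esub>"
      using bij_betw_imp_inj_on[OF bij] x by (metis inj_on_eq_iff m_closed one_closed)+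
    then show "y \<in> h ` Units G"
      using x unfolding Units_def by blast
  qed
  then show ?thesis
    using bij mult unfolding iso_def hom_def units_of_carrier units_of_mult
    by (auto simp: bij_betw_def Units_closed intro: inj_on_subset)
qed

lemma smap_end_apply [simp]:
  "x \<in> simplices X n \<Longrightarrow> smap_end X F j n x = F n (x, ord_const n j)"
  by (simp add: smap_end_def)

section \<open>Vertices, ends and faces of simplices of maps\<close>

context simplicial_set
begin

lemma smap_end_closed:
  assumes "F \<in> maps_from_prism X n X" "j \<le> n"
  shows "smap_end X F j \<in> smaps X X"
proof (rule smapsI)
  show "smap_end X F j k \<in> extensional (simplices X k)" for k by (simp add: smap_end_def)
next
  fix k m x \<theta> assume x: "x \<in> simplices X k" and \<theta>: "\<theta> \<in> ord_maps m k"
  have "\<forall>i\<in>set \<theta>. i \<le> k" using \<theta> by (auto simp: ord_maps_def)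
  then have "ord_comp (ord_const k j) \<theta> = ord_const m j"
    using \<open>\<forall>i\<in>set \<theta>. i \<le> k\<close> \<theta>
    by (auto simp: ord_comp_def ord_const_def ord_maps_def[of m k] less_Suc_eq_le
        simp del: replicate_Suc intro!: replicate_eqI nth_replicate)
  then show "smap_end X F j m (act X k \<theta> x) = act X k \<theta> (smap_end X F j k x)"
    using prism_natural[OF assms(1) x _ \<theta>, of "ord_const k j"] x \<theta> assms(2)
    by (simp add: act_closed)
qed (use assms in \<open>simp add: prism_closed\<close>)

text \<open>\<open>\<Delta>[0]\<close> has exactly one simplex \<open>ord_const k 0\<close> in each
  dimension \<open>k\<close>, so a map out of the prism over \<open>\<Delta>[0]\<close> is the same
  as a map out of \<open>X\<close>.\<close>

lemma smap_end_iso_Map: "(\<lambda>f. smap_end X f 0) \<in> iso (Map_monoid X 0) (End_monoid X)"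
proof -
  let ?h = "\<lambda>f. smap_end X f 0"
  have "?h (f \<otimes>\<^bsub>Map_monoid X 0\<^esub> g) = ?h f \<otimes>\<^bsub>End_monoid X\<^esub> ?h g"
    if "f \<in> maps_from_prism X 0 X" "g \<in> maps_from_prism X 0 X" for f g
  proof (intro ext)
    fix n x
    show "?h (f \<otimes>\<^bsub>Map_monoid X 0\<^esub> g) n x = (?h f \<otimes>\<^bsub>End_monoid X\<^esub> ?h g) n x"
      using prism_closed[OF that(2), of x n "ord_const n 0"]
      by (cases "x \<in> simplices X n")
        (simp_all add: End_monoid_def smap_comp_def compose_def smap_end_def)
  qed
  moreover have "bij_betw ?h (maps_from_prism X 0 X) (smaps X X)"
  proof (rule bij_betwI')
    fix f g assume fg: "f \<in> maps_from_prism X 0 X" "g \<in> maps_from_prism X 0 X"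
    show "(?h f = ?h g) = (f = g)"
    proof
      assume eq: "?h f = ?h g"
      show "f = g"
      proof (rule prism_eqI[OF fg])
        fix k x \<sigma> assume "x \<in> simplices X k" "\<sigma> \<in> ord_maps k 0"
        then show "f k (x, \<sigma>) = g k (x, \<sigma>)"
          using fun_cong[OF fun_cong[OF eq, of k], of x] by (simp add: ord_maps_0)
      qed
    qed simp
  next
    fix f assume "f \<in> maps_from_prism X 0 X"
    then show "?h f \<in> smaps X X" by (rule smap_end_closed) simp
  next
    fix g assume g: "g \<in> smaps X X"
    define f where "f k = (\<lambda>p \<in> simplices X k \<times> ord_maps k 0. g k (fst p))" for k
    have "f \<in> maps_from_prism X 0 X"
      by (rule prismI)
        (simp_all add: f_def smaps_closed[OF g] smaps_natural[OF g] act_closed ord_comp_closed)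
    moreover have "g = ?h f"
      by (rule smaps_eqI[OF g smap_end_closed[OF calculation]]) (simp_all add: f_def)
    ultimately show "\<exists>f\<in>maps_from_prism X 0 X. g = ?h f" by blast
  qed
  ultimately show ?thesis
    unfolding iso_def hom_def
    by (auto simp: End_monoid_def smap_end_closed)
qed

lemma smap_end_one: "smap_end X \<one>\<^bsub>Map_monoid X 0\<^esub> 0 = smap_id X"
  by (auto simp: smap_end_def smap_id_def fun_eq_iff)

lemma smap_end_iso: "(\<lambda>f. smap_end X f 0) \<in> iso (aut_level X 0) (Aut_group X)"
  unfolding aut_level_def Aut_group_def
  by (rule iso_units_of[OF monoid_Map smap_end_iso_Map])
    (simp add: smap_end_one End_monoid_def)

text \<open>Face 0 omits vertex 0, hence restricts to vertex 1. The pair of faces in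
  \<open>sphere_rel\<close> therefore has the same order as the pair \<open>(g, f)\<close> in
  \<open>aut_htpy_rel\<close>.\<close>

lemma smap_end_face:
  "smap_end X (face (aut_sset X) 1 0 F) 0 = smap_end X F 1"
  "smap_end X (face (aut_sset X) 1 1 F) 0 = smap_end X F 0"
proof -
  have "[j] \<in> ord_maps 0 1" if "j \<le> 1" for j using that by (simp add: ord_maps_def)
  moreover have "ord_comp [j] (ord_const n 0) = ord_const n j" for n and j
    by (simp add: ord_comp_def ord_const_def)
  ultimately show "smap_end X (face (aut_sset X) 1 0 F) 0 = smap_end X F 1"
    "smap_end X (face (aut_sset X) 1 1 F) 0 = smap_end X F 0"
    by (auto simp: smap_end_def face_def ord_list_simps aut_sset_def fun_eq_iff
        Map_act_apply[where m = 0 and n = "Suc 0"])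
qed

lemma smap_end_face_eq_iff:
  assumes "F \<in> maps_from_prism X 1 X" "f \<in> maps_from_prism X 0 X"
  shows "face (aut_sset X) 1 0 F = f \<longleftrightarrow> smap_end X F 1 = smap_end X f 0"
    and "face (aut_sset X) 1 1 F = f \<longleftrightarrow> smap_end X F 0 = smap_end X f 0"
proof -
  have inj: "inj_on (\<lambda>f. smap_end X f 0) (maps_from_prism X 0 X)"
    using smap_end_iso_Map by (simp add: iso_def bij_betw_def)
  have face: "face (aut_sset X) 1 i F \<in> maps_from_prism X 0 X" if "i \<le> 1" for i
    using Map_act_closed[OF coface_closed[of 1 i], of F] assms(1) that
    by (simp add: face_def aut_sset_def)
  show "face (aut_sset X) 1 0 F = f \<longleftrightarrow> smap_end X F 1 = smap_end X f 0"
    using inj_on_eq_iff[OF inj face[of 0] assms(2)] smap_end_face(1)[of F] by simp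
  show "face (aut_sset X) 1 1 F = f \<longleftrightarrow> smap_end X F 0 = smap_end X f 0"
    using inj_on_eq_iff[OF inj face[of 1] assms(2)] smap_end_face(2)[of F] by simp
qed

text \<open>An edge of \<open>\<Delta>[Suc n]\<close> that avoids the vertex \<open>l\<close> lies
  in the face opposite to \<open>l\<close>.\<close>

lemma edge_eq_if_face_eq:
  assumes eq: "face (aut_sset X) (Suc n) l F = face (aut_sset X) (Suc n) l G"
    and "l \<le> Suc n" "x \<in> simplices X 1" "p \<le> q" "q \<le> Suc n" "p \<noteq> l" "q \<noteq> l"
  shows "F 1 (x, [p, q]) = G 1 (x, [p, q])"
proof -
  \<comment> \<open>\<open>?s\<close> undoes the coface omitting \<open>l\<close> on all vertices
    other than \<open>l\<close>.\<close>
  let ?s = "\<lambda>i. if i < l then i else i - 1"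
  have s: "[?s p, ?s q] \<in> ord_maps 1 n" "ord_comp (coface (Suc n) l) [?s p, ?s q] = [p, q]"
    using assms by (auto simp: ord_maps_def ord_comp_def coface_def nth_append simp del: upt_Suc)
  have l: "coface (Suc n) l \<in> ord_maps n (Suc n)"
    using coface_closed[of "Suc n" l] assms by simp
  show ?thesis
    using fun_cong[OF fun_cong[OF eq, of 1], of "(x, [?s p, ?s q])"] assms(3) s(2)
      Map_act_apply[OF l assms(3) s(1)]
    by (simp add: face_def aut_sset_def)
qed

end

section \<open>Components and outer automorphisms\<close>

context partial_group
begin

text \<open>Under the identification of vertices with automorphisms, the two relations differ only
  in asking that the homotopy be invertible, which \<open>homotopy_invertible\<close>
  supplies.\<close>

lemma aut_htpy_rel_image:
  defines "R \<equiv> sphere_rel (aut_sset M) \<one>\<^bsub>aut_level M 0\<^esub> 0"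
  assumes x: "x \<in> carrier (aut_level M 0)"
  shows "aut_htpy_rel M `` {smap_end M x 0} = (\<lambda>f. smap_end M f 0) ` (R `` {x})"
proof -
  let ?h = "\<lambda>f. smap_end M f 0"
  have h: "?h ` carrier (aut_level M 0) = carrier (Aut_group M)"
    using smap_end_iso by (simp add: iso_def bij_betw_def)
  show ?thesis
  proof (intro equalityI subsetI)
    fix g assume "g \<in> aut_htpy_rel M `` {?h x}"
    then obtain F where F: "F \<in> maps_from_prism M 1 M" "smap_end M F 0 = g" "smap_end M F 1 = ?h x"
      and g: "g \<in> carrier (Aut_group M)" and hx: "?h x \<in> carrier (Aut_group M)"
      by (auto simp: aut_htpy_rel_def homotopy_from_to_def)
    have "F \<in> carrier (aut_level M 1)"
      using F g hx by (intro homotopy_invertible) auto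
    moreover have "face (aut_sset M) 1 0 F = x"
      using smap_end_face_eq_iff(1)[OF F(1) aut_levelD[OF x]] F by simp
    ultimately have "(x, face (aut_sset M) 1 1 F) \<in> R"
      unfolding R_def sphere_rel_0_aut by blast
    moreover have "g = ?h (face (aut_sset M) 1 1 F)"
      using smap_end_face(2)[of F] F by simp
    ultimately show "g \<in> ?h ` (R `` {x})" by blast
  next
    fix g assume "g \<in> ?h ` (R `` {x})"
    then obtain F where F: "F \<in> carrier (aut_level M 1)" "face (aut_sset M) 1 0 F = x"
      "g = ?h (face (aut_sset M) 1 1 F)"
      unfolding R_def sphere_rel_0_aut by auto
    then have "face (aut_sset M) 1 1 F \<in> carrier (aut_level M 0)"
      using group_hom.hom_closed[OF face_aut_hom[of 1 0]] by simp
    then have "?h x \<in> carrier (Aut_group M)" "g \<in> carrier (Aut_group M)"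
      using x F h by blast+
    then show "g \<in> aut_htpy_rel M `` {?h x}"
      using F aut_levelD[OF F(1)] smap_end_face[of F]
      by (auto simp: aut_htpy_rel_def homotopy_from_to_def)
  qed
qed

text \<open>A class is sent to its image under the isomorphism of vertex groups. Both products are
  products of subsets, so multiplicativity is inherited from that isomorphism.\<close>

lemma pi0_aut_iso_Out: "image (\<lambda>f. smap_end M f 0) \<in> iso (pi0_aut M) (Out_group M)"
proof -
  let ?h = "\<lambda>f. smap_end M f 0" and ?R = "sphere_rel (aut_sset M) \<one>\<^bsub>aut_level M 0\<^esub> 0"
  have bij: "bij_betw ?h (carrier (aut_level M 0)) (carrier (Aut_group M))"
    and mult: "\<And>x y. x \<in> carrier (aut_level M 0) \<Longrightarrow> y \<in> carrier (aut_level M 0) \<Longrightarrow>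
      ?h (x \<otimes>\<^bsub>aut_level M 0\<^esub> y) = ?h x \<otimes>\<^bsub>Aut_group M\<^esub> ?h y"
    using smap_end_iso by (auto simp: iso_def hom_def)
  have pi0: "carrier (pi0_aut M) = carrier (aut_level M 0) // ?R"
    by (simp add: pi0_aut_def homotopy_set_def spheres_def)
  have sub: "A \<subseteq> carrier (aut_level M 0)" if "A \<in> carrier (pi0_aut M)" for A
    using that unfolding pi0 quotient_def by (auto simp: sphere_rel_def spheres_def)
  have "image ?h ` carrier (pi0_aut M) = carrier (Aut_group M) // aut_htpy_rel M"
    unfolding pi0 quotient_def bij_betw_imp_surj_on[OF bij, symmetric]
    using aut_htpy_rel_image by (auto simp: image_iff)
  moreover have "inj_on (image ?h) (carrier (pi0_aut M))"
    using inj_on_image_Pow[OF bij_betw_imp_inj_on[OF bij]] by (rule inj_on_subset) (use sub in auto)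
  moreover have "?h ` (A <#>\<^bsub>aut_level M 0\<^esub> B) = ?h ` A <#>\<^bsub>Aut_group M\<^esub> ?h ` B"
    if "A \<in> carrier (pi0_aut M)" "B \<in> carrier (pi0_aut M)" for A B
    using sub[OF that(1)] sub[OF that(2)] mult unfolding set_mult_def
    by (auto simp: image_iff subset_iff) metis+
  ultimately show ?thesis
    unfolding iso_def hom_def bij_betw_def
    by (auto simp: Out_group_def pi0_aut_def[THEN arg_cong[where f = mult]])
qed

lemma group_Out: "group (Out_group M)"
proof -
  have "(\<lambda>f. smap_end M f 0) ` \<one>\<^bsub>pi0_aut M\<^esub> = \<one>\<^bsub>Out_group M\<^esub>"
    using aut_htpy_rel_image[of "\<one>\<^bsub>aut_level M 0\<^esub>"] group.subgroup_self[OF group_aut_level[of 0]]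
      subgroup.one_closed[of "carrier (aut_level M 0)" "aut_level M 0"]
    by (simp add: Out_group_def pi0_aut_def smap_end_one)
  then show ?thesis
    by (rule group_of_iso[OF group_pi0_aut pi0_aut_iso_Out])
qed

end

section \<open>The fundamental group as a subgroup of the 1-simplices\<close>

context partial_monoid
begin

text \<open>Uniqueness of fillers of inner horns: the faces 0 and 2 contain every edge of
  \<open>\<Delta>[2]\<close> except \<open>[0, 2]\<close>, and \<open>prism_inner_horn_eqI\<close>
  recovers that one.\<close>

lemma aut_inner_horn_eqI:
  assumes "z \<in> carrier (aut_level M 2)" "z' \<in> carrier (aut_level M 2)"
    and "face (aut_sset M) 2 0 z = face (aut_sset M) 2 0 z'"
    and "face (aut_sset M) 2 2 z = face (aut_sset M) 2 2 z'"
  shows "z = z'"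
proof (rule prism_inner_horn_eqI[OF aut_levelD[OF assms(1)] aut_levelD[OF assms(2)]])
  fix x i j assume x: "x \<in> simplices M 1" and ij: "i \<le> j" "j \<le> 2" "(i, j) \<noteq> (0, 2::nat)"
  then consider "i \<noteq> 0" "j \<noteq> 0" | "i \<noteq> 2" "j \<noteq> 2" by fastforce
  then show "z 1 (x, [i, j]) = z' 1 (x, [i, j])"
    using edge_eq_if_face_eq[of 1 0 z z' x i j] edge_eq_if_face_eq[of 1 2 z z' x i j] x ij assms(3,4)
    by cases (simp_all add: numeral_2_eq_2)
qed

lemma spheres_aut_1:
  "spheres (aut_sset M) \<one>\<^bsub>aut_level M 0\<^esub> 1 = {F \<in> carrier (aut_level M 1).
     face (aut_sset M) 1 0 F = \<one>\<^bsub>aut_level M 0\<^esub> \<and> face (aut_sset M) 1 1 F = \<one>\<^bsub>aut_level M 0\<^esub>}"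
  using const_simplex_aut[of 0] by (auto simp: spheres_def le_Suc_eq)

text \<open>Both faces are homomorphisms, and the spherical 1-simplices are the intersection of
  their kernels.\<close>

lemma subgroup_spheres_aut_1:
  "subgroup (spheres (aut_sset M) \<one>\<^bsub>aut_level M 0\<^esub> 1) (aut_level M 1)"
proof -
  interpret G: group "aut_level M 1" by (rule group_aut_level)
  have kernel: "subgroup (kernel (aut_level M 1) (aut_level M 0) (face (aut_sset M) 1 i)) (aut_level M 1)"
    if "i \<le> 1" for i
    using group_hom.subgroup_kernel[OF face_aut_hom[of i 0]] that by simp
  have "spheres (aut_sset M) \<one>\<^bsub>aut_level M 0\<^esub> 1 =
      kernel (aut_level M 1) (aut_level M 0) (face (aut_sset M) 1 0) \<inter>
      kernel (aut_level M 1) (aut_level M 0) (face (aut_sset M) 1 1)"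
    unfolding spheres_aut_1 kernel_def by auto
  then show ?thesis
    using G.subgroups_Inter_pair[OF kernel[of 0] kernel[of 1]] by simp
qed

text \<open>Simplicial identities for the degeneracies \<open>s_0\<close> and \<open>s_1\<close>,
  given by \<open>[0, 0, 1]\<close> and \<open>[0, 1, 1]\<close>. The faces \<open>d_2 s_0\<close>
  and \<open>d_0 s_1\<close> pass through a vertex of \<open>F\<close>, hence are units.\<close>

lemma degeneracy_faces_aut:
  assumes F: "F \<in> spheres (aut_sset M) \<one>\<^bsub>aut_level M 0\<^esub> 1"
  shows "act (aut_sset M) 1 [0, 0, 1] F \<in> carrier (aut_level M 2)"
    and "act (aut_sset M) 1 [0, 1, 1] F \<in> carrier (aut_level M 2)"
    and "face (aut_sset M) 2 0 (act (aut_sset M) 1 [0, 0, 1] F) = F"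
    and "face (aut_sset M) 2 1 (act (aut_sset M) 1 [0, 0, 1] F) = F"
    and "face (aut_sset M) 2 2 (act (aut_sset M) 1 [0, 0, 1] F) = \<one>\<^bsub>aut_level M 1\<^esub>"
    and "face (aut_sset M) 2 0 (act (aut_sset M) 1 [0, 1, 1] F) = \<one>\<^bsub>aut_level M 1\<^esub>"
    and "face (aut_sset M) 2 1 (act (aut_sset M) 1 [0, 1, 1] F) = F"
    and "face (aut_sset M) 2 2 (act (aut_sset M) 1 [0, 1, 1] F) = F"
proof -
  have F1: "F \<in> carrier (aut_level M 1)"
    and dF: "face (aut_sset M) 1 0 F = \<one>\<^bsub>aut_level M 0\<^esub>" "face (aut_sset M) 1 1 F = \<one>\<^bsub>aut_level M 0\<^esub>"
    using F unfolding spheres_aut_1 by auto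
  have deg: "[0, 0, 1] \<in> ord_maps 2 1" "[0, 1, 1] \<in> ord_maps 2 1" by (simp_all add: ord_maps_triangle)
  show "act (aut_sset M) 1 [0, 0, 1] F \<in> carrier (aut_level M 2)"
    "act (aut_sset M) 1 [0, 1, 1] F \<in> carrier (aut_level M 2)"
    using group_hom.hom_closed[OF act_aut_hom[OF deg(1)] F1]
      group_hom.hom_closed[OF act_aut_hom[OF deg(2)] F1] .
  have const: "act (aut_sset M) 1 [i, i] F = \<one>\<^bsub>aut_level M 1\<^esub>" if "i \<le> 1" for i
  proof -
    have i: "[i] \<in> ord_maps 0 1" and o: "[0, 0] \<in> ord_maps 1 0"
      using that by (simp_all add: ord_maps_def)
    have "act (aut_sset M) 1 [i] F = \<one>\<^bsub>aut_level M 0\<^esub>"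
      using that dF by (auto simp: face_def ord_list_simps le_Suc_eq)
    then show ?thesis
      using aut_act_comp[OF i o F1, of 0 1 1] group_hom.hom_one[OF act_aut_hom[OF o], of 0]
      by (simp add: ord_comp_def)
  qed
  have id: "act (aut_sset M) 1 [0, 1] F = F"
    using aut_act_id[OF F1, of 1] by (simp add: ord_list_simps)
  show "face (aut_sset M) 2 0 (act (aut_sset M) 1 [0, 0, 1] F) = F"
    "face (aut_sset M) 2 1 (act (aut_sset M) 1 [0, 0, 1] F) = F"
    "face (aut_sset M) 2 2 (act (aut_sset M) 1 [0, 0, 1] F) = \<one>\<^bsub>aut_level M 1\<^esub>"
    "face (aut_sset M) 2 0 (act (aut_sset M) 1 [0, 1, 1] F) = \<one>\<^bsub>aut_level M 1\<^esub>"
    "face (aut_sset M) 2 1 (act (aut_sset M) 1 [0, 1, 1] F) = F"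
    "face (aut_sset M) 2 2 (act (aut_sset M) 1 [0, 1, 1] F) = F"
    using face_aut_degen[OF _ _ F1, of _ 1] deg id const[of 0] const[of 1]
    by (simp_all add: numeral_2_eq_2 ord_list_simps ord_comp_def)
qed

text \<open>A 2-simplex relating \<open>x\<close> to \<open>x'\<close> has the same outer faces as
  the degenerate simplex \<open>s_1 x'\<close>, so it equals that simplex, and comparing the middle
  faces gives \<open>x = x'\<close>. Homotopy classes are singletons.\<close>

lemma sphere_rel_aut_1:
  "sphere_rel (aut_sset M) \<one>\<^bsub>aut_level M 0\<^esub> 1 = Id_on (spheres (aut_sset M) \<one>\<^bsub>aut_level M 0\<^esub> 1)"
  (is "?R = Id_on ?K")
proof (intro equalityI subsetI)
  fix p assume "p \<in> ?R"
  then obtain x x' y where p: "p = (x, x')" "x \<in> ?K" "x' \<in> ?K"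
    and y: "y \<in> carrier (aut_level M 2)" "face (aut_sset M) 2 1 y = x" "face (aut_sset M) 2 2 y = x'"
      "face (aut_sset M) 2 0 y = \<one>\<^bsub>aut_level M 1\<^esub>"
    using const_simplex_aut[of 1] by (auto simp: sphere_rel_def numeral_2_eq_2)
  note deg = degeneracy_faces_aut[OF p(3)]
  have "y = act (aut_sset M) 1 [0, 1, 1] x'"
    by (rule aut_inner_horn_eqI) (use y deg in simp_all)
  then show "p \<in> Id_on ?K" using y(2) deg p by auto
next
  fix p assume "p \<in> Id_on ?K"
  then obtain x where x: "p = (x, x)" "x \<in> ?K" by auto
  then show "p \<in> ?R"
    using degeneracy_faces_aut[OF x(2)] const_simplex_aut[of 1]
    by (auto simp: sphere_rel_def numeral_2_eq_2)
qed

lemma pi1_aut_mult: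
  assumes x: "x \<in> spheres (aut_sset M) \<one>\<^bsub>aut_level M 0\<^esub> 1"
    and y: "y \<in> spheres (aut_sset M) \<one>\<^bsub>aut_level M 0\<^esub> 1"
  shows "{x} \<otimes>\<^bsub>pi_aut 1 M\<^esub> {y} = {x \<otimes>\<^bsub>aut_level M 1\<^esub> y}"
proof -
  interpret G1: group "aut_level M 1" by (rule group_aut_level)
  interpret G2: group "aut_level M 2" by (rule group_aut_level)
  let ?K = "spheres (aut_sset M) \<one>\<^bsub>aut_level M 0\<^esub> 1"
  \<comment> \<open>The simplex \<open>s_0 x\<close> has outer faces \<open>x\<close> and 1, while
    \<open>s_1 y\<close> has outer faces 1 and \<open>y\<close>. Their product has outer faces
    \<open>x\<close> and \<open>y\<close> and middle face the product of \<open>x\<close> and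
    \<open>y\<close>; it is the only such filler.\<close>
  let ?z = "act (aut_sset M) 1 [0, 0, 1] x \<otimes>\<^bsub>aut_level M 2\<^esub> act (aut_sset M) 1 [0, 1, 1] y"
  have xy: "x \<in> carrier (aut_level M 1)" "y \<in> carrier (aut_level M 1)"
    using x y by (auto simp: spheres_def)
  note deg = degeneracy_faces_aut[OF x] degeneracy_faces_aut[OF y]
  have face_hom: "face (aut_sset M) 2 i (f \<otimes>\<^bsub>aut_level M 2\<^esub> g) =
      face (aut_sset M) 2 i f \<otimes>\<^bsub>aut_level M 1\<^esub> face (aut_sset M) 2 i g"
    if "i \<le> 2" "f \<in> carrier (aut_level M 2)" "g \<in> carrier (aut_level M 2)" for i f g
    using group_hom.hom_mult[OF face_aut_hom[of i 1]] that by (simp only: numeral_2_eq_2 One_nat_def)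
  have z: "?z \<in> carrier (aut_level M 2)"
    using deg by blast
  have dz: "face (aut_sset M) 2 0 ?z = x" "face (aut_sset M) 2 2 ?z = y"
    "face (aut_sset M) 2 1 ?z = x \<otimes>\<^bsub>aut_level M 1\<^esub> y"
    using face_hom[OF _ deg(1) deg(10), of 0] face_hom[OF _ deg(1) deg(10), of 1]
      face_hom[OF _ deg(1) deg(10), of 2] deg xy G1.l_one G1.r_one by simp_all
  have "{face (aut_sset M) 2 1 w | w. w \<in> carrier (aut_level M 2) \<and>
      face (aut_sset M) 2 0 w = x \<and> face (aut_sset M) 2 2 w = y} = {x \<otimes>\<^bsub>aut_level M 1\<^esub> y}"
  proof -
    obtain z where z: "z \<in> carrier (aut_level M 2)" and dz: "face (aut_sset M) 2 0 z = x"
      "face (aut_sset M) 2 2 z = y" "face (aut_sset M) 2 1 z = x \<otimes>\<^bsub>aut_level M 1\<^esub> y"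
      using z dz by iprover
    have "w = z" if "w \<in> carrier (aut_level M 2)" "face (aut_sset M) 2 0 w = x"
      "face (aut_sset M) 2 2 w = y" for w
      by (rule aut_inner_horn_eqI[OF that(1) z]) (simp_all only: that dz)
    then have "{w. w \<in> carrier (aut_level M 2) \<and> face (aut_sset M) 2 0 w = x \<and>
        face (aut_sset M) 2 2 w = y} = {z}"
      using z dz by blast
    then show ?thesis
      unfolding setcompr_eq_image using dz(3) by simp
  qed
  moreover have "x \<otimes>\<^bsub>aut_level M 1\<^esub> y \<in> ?K"
    using x y by (rule subgroup.m_closed[OF subgroup_spheres_aut_1])
  moreover have "{x} \<otimes>\<^bsub>pi_aut 1 M\<^esub> {y} = Id_on ?K `` {face (aut_sset M) 2 1 w | w.
      w \<in> carrier (aut_level M 2) \<and> face (aut_sset M) 2 0 w = x \<and> face (aut_sset M) 2 2 w = y}"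
    unfolding sphere_rel_aut_1[symmetric] by (simp add: pi_aut_def homotopy_group_def numeral_2_eq_2)
  ultimately show ?thesis by auto
qed

lemma singleton_iso_pi1_aut:
  "(\<lambda>x. {x}) \<in> iso (aut_level M 1\<lparr>carrier := spheres (aut_sset M) \<one>\<^bsub>aut_level M 0\<^esub> 1\<rparr>) (pi_aut 1 M)"
proof -
  let ?K = "spheres (aut_sset M) \<one>\<^bsub>aut_level M 0\<^esub> 1"
  have "carrier (pi_aut 1 M) = ?K // Id_on ?K"
    unfolding sphere_rel_aut_1[symmetric] by (simp add: pi_aut_def homotopy_group_def homotopy_set_def)
  also have "\<dots> = (\<lambda>x. {x}) ` ?K"
    by (auto simp: quotient_def)
  finally show ?thesis
    using pi1_aut_mult by (auto simp: iso_def hom_def bij_betw_def simp del: aut_level_mult One_nat_def)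
qed

lemma group_pi1_aut: "group (pi_aut 1 M)"
proof -
  interpret G: group "aut_level M 1" by (rule group_aut_level)
  have "\<one>\<^bsub>pi_aut 1 M\<^esub> = Id_on (spheres (aut_sset M) \<one>\<^bsub>aut_level M 0\<^esub> 1) `` {\<one>\<^bsub>aut_level M 1\<^esub>}"
    using const_simplex_aut[of 1] unfolding sphere_rel_aut_1[symmetric]
    by (simp add: pi_aut_def homotopy_group_def)
  then have "\<one>\<^bsub>pi_aut 1 M\<^esub> = {\<one>\<^bsub>aut_level M 1\<^esub>}"
    using subgroup.one_closed[OF subgroup_spheres_aut_1] by auto
  then show ?thesis
    using group_of_iso[OF subgroup.subgroup_is_group[OF subgroup_spheres_aut_1 G.group_axioms]
        singleton_iso_pi1_aut] by simp
qed

section \<open>Homotopy groups in degrees at least 2\<close>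

lemma spheres_aut_ge_2:
  assumes "2 \<le> n"
  shows "spheres (aut_sset M) \<one>\<^bsub>aut_level M 0\<^esub> n = {\<one>\<^bsub>aut_level M n\<^esub>}"
proof -
  obtain m where m: "n = Suc m" "1 \<le> m" using assms by (cases n) auto
  have face_one: "face (aut_sset M) n i \<one>\<^bsub>aut_level M n\<^esub> = \<one>\<^bsub>aut_level M m\<^esub>" if "i \<le> n" for i
    using group_hom.hom_one[OF face_aut_hom[of i m]] that m by simp
  have one: "\<one>\<^bsub>aut_level M n\<^esub> \<in> carrier (aut_level M n)"
    using group_aut_level by (rule group.subgroup_self[THEN subgroup.one_closed])
  have "F = \<one>\<^bsub>aut_level M n\<^esub>" if "F \<in> spheres (aut_sset M) \<one>\<^bsub>aut_level M 0\<^esub> n" for F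
  proof (rule prism_eq_on_edgesI)
    have F: "F \<in> carrier (aut_level M n)" "\<And>i. i \<le> n \<Longrightarrow> face (aut_sset M) n i F = \<one>\<^bsub>aut_level M m\<^esub>"
      using that m const_simplex_aut[of m] by (auto simp: spheres_def)
    show "F \<in> maps_from_prism M n M" "\<one>\<^bsub>aut_level M n\<^esub> \<in> maps_from_prism M n M"
      using F one by (auto intro: aut_levelD)
    fix x p q assume x: "x \<in> simplices M 1" and pq: "p \<le> q" "q \<le> n"
    \<comment> \<open>An edge has at most two vertices, so it misses one of 0, 1, 2. It lies in the
      opposite face, where \<open>F\<close> is the unit.\<close>
    have "\<exists>l\<le>2. p \<noteq> l \<and> q \<noteq> l" by presburger
    then obtain l where l: "l \<le> n" "p \<noteq> l" "q \<noteq> l" using assms by (meson le_trans)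
    show "F 1 (x, [p, q]) = \<one>\<^bsub>aut_level M n\<^esub> 1 (x, [p, q])"
      using edge_eq_if_face_eq[of m l F "\<one>\<^bsub>aut_level M n\<^esub>" x p q] F(2)[OF l(1)] face_one[OF l(1)]
        l x pq m by simp
  qed
  moreover have "\<one>\<^bsub>aut_level M n\<^esub> \<in> spheres (aut_sset M) \<one>\<^bsub>aut_level M 0\<^esub> n"
    using one face_one const_simplex_aut[of m] m by (simp add: spheres_def)
  ultimately show ?thesis by blast
qed

text \<open>The unit of level \<open>Suc n\<close> has only units as faces; it witnesses both
  reflexivity of \<open>sphere_rel\<close> and the product.\<close>

lemma pi_aut_ge_2:
  assumes "2 \<le> n"
  shows "carrier (pi_aut n M) = {{\<one>\<^bsub>aut_level M n\<^esub>}}"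
    and "\<one>\<^bsub>pi_aut n M\<^esub> = {\<one>\<^bsub>aut_level M n\<^esub>}"
    and "{\<one>\<^bsub>aut_level M n\<^esub>} \<otimes>\<^bsub>pi_aut n M\<^esub> {\<one>\<^bsub>aut_level M n\<^esub>} = {\<one>\<^bsub>aut_level M n\<^esub>}"
proof -
  let ?e = "\<one>\<^bsub>aut_level M n\<^esub>" and ?e' = "\<one>\<^bsub>aut_level M (Suc n)\<^esub>"
  have e': "?e' \<in> carrier (aut_level M (Suc n))"
    "\<And>i. i \<le> Suc n \<Longrightarrow> face (aut_sset M) (Suc n) i ?e' = ?e"
    using group_hom.hom_one[OF face_aut_hom[of _ n]]
      group.subgroup_self[OF group_aut_level[of "Suc n"], THEN subgroup.one_closed] by auto
  have R: "sphere_rel (aut_sset M) \<one>\<^bsub>aut_level M 0\<^esub> n = {(?e, ?e)}"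
  proof -
    have "\<exists>y\<in>simplices (aut_sset M) (Suc n). face (aut_sset M) (Suc n) n y = ?e \<and>
        face (aut_sset M) (Suc n) (Suc n) y = ?e \<and>
        (\<forall>i<n. face (aut_sset M) (Suc n) i y = const_simplex (aut_sset M) \<one>\<^bsub>aut_level M 0\<^esub> n)"
      unfolding const_simplex_aut by (rule bexI[of _ ?e']) (use e' in auto)
    then show ?thesis
      unfolding sphere_rel_def spheres_aut_ge_2[OF assms] by blast
  qed
  have "{?e} // {(?e, ?e)} = {{?e}}"
    unfolding quotient_def by blast
  then show "carrier (pi_aut n M) = {{?e}}"
    unfolding pi_aut_def homotopy_group_def homotopy_set_def R spheres_aut_ge_2[OF assms]
    by (simp only: partial_object.simps)
  show "\<one>\<^bsub>pi_aut n M\<^esub> = {?e}"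
    unfolding pi_aut_def homotopy_group_def R const_simplex_aut monoid.simps by blast
  have "?e \<in> {face (aut_sset M) (Suc n) n z | z. z \<in> simplices (aut_sset M) (Suc n) \<and>
      face (aut_sset M) (Suc n) (n - 1) z \<in> {?e} \<and> face (aut_sset M) (Suc n) (Suc n) z \<in> {?e} \<and>
      (\<forall>i<n - 1. face (aut_sset M) (Suc n) i z = const_simplex (aut_sset M) \<one>\<^bsub>aut_level M 0\<^esub> n)}"
    using e' unfolding const_simplex_aut by (intro CollectI exI[of _ ?e']) auto
  then show "{?e} \<otimes>\<^bsub>pi_aut n M\<^esub> {?e} = {?e}"
    unfolding pi_aut_def homotopy_group_def monoid.simps R by blast
qed

lemma pi_aut_ge_2_trivial:
  assumes "2 \<le> n"
  shows "group (pi_aut n M) \<and> pi_aut n M \<cong> singleton_group a"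
proof -
  note pi = pi_aut_ge_2[OF assms]
  have "group (pi_aut n M)"
    by (rule groupI) (simp_all add: pi del: aut_level_one)
  moreover have "(\<lambda>_. a) \<in> iso (pi_aut n M) (singleton_group a)"
    by (auto simp: iso_def hom_def bij_betw_def pi singleton_group_def)
  ultimately show ?thesis
    by (auto intro: is_isoI)
qed

end

section \<open>Self-homotopies of the identity and the center\<close>

context partial_group
begin

lemma smap_id_Aut: "smap_id M \<in> carrier (Aut_group M)"
  using smap_end_iso group.subgroup_self[OF group_aut_level[of 0], THEN subgroup.one_closed]
  by (auto simp: iso_def bij_betw_def smap_end_one[symmetric])

text \<open>Invertibility, part of being a simplex of \<open>aut_sset\<close>, comes for free from
  \<open>homotopy_invertible\<close> since the ends are identities.\<close>

lemma spheres_aut_1_iff_homotopy: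
  "F \<in> spheres (aut_sset M) \<one>\<^bsub>aut_level M 0\<^esub> 1 \<longleftrightarrow>
    homotopy_from_to M M (smap_id M) (smap_id M) F"
proof
  assume "F \<in> spheres (aut_sset M) \<one>\<^bsub>aut_level M 0\<^esub> 1"
  then have F: "F \<in> carrier (aut_level M 1)" "face (aut_sset M) 1 0 F = \<one>\<^bsub>aut_level M 0\<^esub>"
    "face (aut_sset M) 1 1 F = \<one>\<^bsub>aut_level M 0\<^esub>"
    unfolding spheres_aut_1 by auto
  then show "homotopy_from_to M M (smap_id M) (smap_id M) F"
    using aut_levelD[OF F(1)] smap_end_face[of F] by (simp add: homotopy_from_to_def smap_end_one)
next
  assume "homotopy_from_to M M (smap_id M) (smap_id M) F"
  then have F: "F \<in> maps_from_prism M 1 M" "smap_end M F 0 = smap_id M" "smap_end M F 1 = smap_id M"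
    by (auto simp: homotopy_from_to_def)
  then have "F \<in> carrier (aut_level M 1)"
    using smap_id_Aut by (intro homotopy_invertible) auto
  then show "F \<in> spheres (aut_sset M) \<one>\<^bsub>aut_level M 0\<^esub> 1"
    unfolding spheres_aut_1
    using smap_end_face_eq_iff[OF F(1) Map_one_closed] F by (simp add: smap_end_one)
qed

text \<open>\<open>F (x, [0, 1])\<close> is the product of \<open>\<eta>\<close> and
  \<open>g x\<close>, hence depends only on \<open>\<eta>\<close> and the source \<open>g\<close> of
  the homotopy.\<close>

lemma homotopy_edge_eq:
  assumes F: "homotopy_from_to M M g f F" and F': "homotopy_from_to M M g f' F'"
    and \<eta>: "F 1 (punit M, [0, 1]) = F' 1 (punit M, [0, 1])" and x: "x \<in> simplices M 1"
  shows "F 1 (x, [0, 1]) = F' 1 (x, [0, 1])"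
proof -
  have F: "F \<in> maps_from_prism M 1 M" "smap_end M F 1 = g"
    and F': "F' \<in> maps_from_prism M 1 M" "smap_end M F' 1 = g"
    using assms by (auto simp: homotopy_from_to_def)
  have end1: "F 1 (x, [1, 1]) = F' 1 (x, [1, 1])"
    using fun_cong[OF fun_cong[OF F(2)[folded F'(2)], of 1], of x] x by (simp add: ord_const_def)
  obtain p where p: "p \<in> simplices M 2" "act M 2 [0, 1] p = F 1 (punit M, [0, 1])"
    "act M 2 [1, 2] p = F 1 (x, [1, 1])" "act M 2 [0, 2] p = F 1 (x, [0, 1])"
    using prism_triangle_left[OF F(1) x, of 0 1] by auto
  obtain q where q: "q \<in> simplices M 2" "act M 2 [0, 1] q = F' 1 (punit M, [0, 1])"
    "act M 2 [1, 2] q = F' 1 (x, [1, 1])" "act M 2 [0, 2] q = F' 1 (x, [0, 1])"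
    using prism_triangle_left[OF F'(1) x, of 0 1] by auto
  have "p = q" by (rule triangle_eqI) (use p q end1 \<eta> in auto)
  then show ?thesis using p q by simp
qed

text \<open>The product of \<open>c x\<close> and \<open>\<eta>\<close> equals that of
  \<open>\<eta>\<close> and \<open>g x\<close>; cancelling \<open>\<eta>\<close> on the right
  determines \<open>c\<close>. This makes the description in \<open>conj_aut\<close>
  definite.\<close>

lemma homotopic_via_unique:
  assumes "homotopic_via M c \<eta> g" "homotopic_via M c' \<eta> g"
  shows "c = c'"
proof -
  obtain F F' where F: "homotopy_from_to M M g c F" "F 1 (punit M, [0, 1]) = \<eta>"
    and F': "homotopy_from_to M M g c' F'" "F' 1 (punit M, [0, 1]) = \<eta>"
    using assms by (auto simp: homotopic_via_def)
  then have FM: "F \<in> maps_from_prism M 1 M" "smap_end M F 0 = c"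
    and F'M: "F' \<in> maps_from_prism M 1 M" "smap_end M F' 0 = c'"
    by (auto simp: homotopy_from_to_def)
  show ?thesis
  proof (rule smaps_eq_on_edgesI[OF simplicial_set_axioms])
    show "c \<in> smaps M M" "c' \<in> smaps M M"
      using FM F'M smap_end_closed[of F 1 0] smap_end_closed[of F' 1 0] by auto
    fix x assume x: "x \<in> simplices M 1"
    obtain p where p: "p \<in> simplices M 2" "act M 2 [0, 1] p = F 1 (x, [0, 0])"
      "act M 2 [1, 2] p = \<eta>" "act M 2 [0, 2] p = F 1 (x, [0, 1])"
      using prism_triangle_right[OF FM(1) x, of 0 1] F by auto
    obtain q where q: "q \<in> simplices M 2" "act M 2 [0, 1] q = F' 1 (x, [0, 0])"
      "act M 2 [1, 2] q = \<eta>" "act M 2 [0, 2] q = F' 1 (x, [0, 1])"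
      using prism_triangle_right[OF F'M(1) x, of 0 1] F' by auto
    have "F 1 (x, [0, 0]) = F' 1 (x, [0, 0])"
      using right_cancel[OF p(1) q(1)] p q homotopy_edge_eq[OF F(1) F'(1) _ x] F(2) F'(2) by simp
    moreover have "c 1 x = F 1 (x, [0, 0])" "c' 1 x = F' 1 (x, [0, 0])"
      using x unfolding FM(2)[symmetric] F'M(2)[symmetric] by (simp_all add: ord_const_def)
    ultimately show "c 1 x = c' 1 x" by simp
  qed
qed

lemma center_eq_homotopic:
  "center M = {\<eta>. homotopic_via M (smap_id M) \<eta> (smap_id M)}"
proof (intro equalityI subsetI CollectI)
  fix \<eta> assume \<eta>: "\<eta> \<in> center M"
  then obtain c where c: "c \<in> carrier (Aut_group M)" "homotopic_via M c \<eta> (smap_id M)"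
    by (auto simp: center_def normalizer_def)
  then have "conj_aut M \<eta> = c"
    unfolding conj_aut_def using homotopic_via_unique by (intro the_equality) auto
  then show "homotopic_via M (smap_id M) \<eta> (smap_id M)"
    using \<eta> c by (simp add: center_def)
next
  fix \<eta> assume "\<eta> \<in> {\<eta>. homotopic_via M (smap_id M) \<eta> (smap_id M)}"
  then have \<eta>: "homotopic_via M (smap_id M) \<eta> (smap_id M)" by simp
  then have "conj_aut M \<eta> = smap_id M"
    unfolding conj_aut_def using homotopic_via_unique smap_id_Aut by (intro the_equality) auto
  moreover have "\<eta> \<in> simplices M 1"
    using \<eta> prism_closed[of _ M 1 M "punit M" 1 "[0, 1]"] punit_closed
    by (auto simp: homotopic_via_def homotopy_from_to_def ord_maps_edge)
  ultimately show "\<eta> \<in> center M"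
    using \<eta> smap_id_Aut by (auto simp: center_def normalizer_def)
qed

text \<open>Evaluation at the unit over the nondegenerate edge. It is injective because the ends are
  fixed to be identities and \<open>homotopy_edge_eq\<close> settles the remaining edges.\<close>

lemma spheres_iso_center:
  "(\<lambda>F. F 1 (punit M, [0, 1])) \<in>
    iso (aut_level M 1\<lparr>carrier := spheres (aut_sset M) \<one>\<^bsub>aut_level M 0\<^esub> 1\<rparr>) (center_group M)"
proof -
  let ?K = "spheres (aut_sset M) \<one>\<^bsub>aut_level M 0\<^esub> 1"
  let ?E = "\<lambda>F. F 1 (punit M, [0, 1])"
  have K: "F \<in> maps_from_prism M 1 M" "\<And>x. x \<in> simplices M 1 \<Longrightarrow> F 1 (x, [0, 0]) = x"
    "\<And>x. x \<in> simplices M 1 \<Longrightarrow> F 1 (x, [1, 1]) = x" if "F \<in> ?K" for F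
  proof -
    have F: "F \<in> maps_from_prism M 1 M" "smap_end M F 0 = smap_id M" "smap_end M F 1 = smap_id M"
      using that unfolding spheres_aut_1_iff_homotopy by (auto simp: homotopy_from_to_def)
    show "F \<in> maps_from_prism M 1 M" by (rule F)
    fix x assume x: "x \<in> simplices M 1"
    show "F 1 (x, [0, 0]) = x" "F 1 (x, [1, 1]) = x"
      using fun_cong[OF fun_cong[OF F(2), of 1], of x] fun_cong[OF fun_cong[OF F(3), of 1], of x] x
      by (simp_all add: ord_const_def smap_id_def)
  qed
  have E_closed: "?E F \<in> simplices M 1" if "F \<in> ?K" for F
    using prism_closed[OF K(1)[OF that] punit_closed] by (simp add: ord_maps_edge)
  have "center M = ?E ` ?K"
    using spheres_aut_1_iff_homotopy by (auto simp: center_eq_homotopic homotopic_via_def image_iff)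
  moreover have "inj_on ?E ?K"
  proof (rule inj_onI, rule prism_eq_on_edgesI)
    fix F G x and i j :: nat
    assume FG: "F \<in> ?K" "G \<in> ?K" "?E F = ?E G" and x: "x \<in> simplices M 1" and ij: "i \<le> j" "j \<le> 1"
    then have "homotopy_from_to M M (smap_id M) (smap_id M) F"
      "homotopy_from_to M M (smap_id M) (smap_id M) G"
      by (simp_all only: spheres_aut_1_iff_homotopy)
    then have eq: "F 1 (x, [0, 1]) = G 1 (x, [0, 1])"
      using homotopy_edge_eq x FG(3) by blast
    consider "i = 0" "j = 0" | "i = 1" "j = 1" | "i = 0" "j = 1" using ij by linarith
    then show "F 1 (x, [i, j]) = G 1 (x, [i, j])"
      using eq K(2,3)[OF FG(1) x] K(2,3)[OF FG(2) x] by cases simp_all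
  qed (use K in auto)
  moreover have "?E (F \<otimes>\<^bsub>aut_level M 1\<^esub> G) = pmult M (?E F) (?E G)" if F: "F \<in> ?K" and G: "G \<in> ?K" for F G
  proof -
    \<comment> \<open>The value of the product at the unit is \<open>F (?E G, [0, 1])\<close>. The
      left triangle splits it into \<open>?E F\<close> and \<open>F (?E G, [1, 1])\<close>, and the
      latter is \<open>?E G\<close> because \<open>F\<close> ends at the identity.\<close>
    obtain p where p: "p \<in> simplices M 2" "act M 2 [0, 1] p = ?E F"
      "act M 2 [1, 2] p = F 1 (?E G, [1, 1])" "act M 2 [0, 2] p = F 1 (?E G, [0, 1])"
      using prism_triangle_left[OF K(1)[OF F] E_closed[OF G], of 0 1] by auto
    then have "F 1 (?E G, [0, 1]) = pmult M (?E F) (?E G)"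
      using pmult_triangle[OF p(1)] K(3)[OF F E_closed[OF G]] by simp
    then show ?thesis
      using punit_closed by (simp add: ord_maps_edge)
  qed
  ultimately show ?thesis
    by (auto simp: iso_def hom_def bij_betw_def center_group_def simp del: aut_level_mult One_nat_def)
qed

lemma group_center: "group (center_group M)"
proof -
  interpret G: group "aut_level M 1" by (rule group_aut_level)
  have "\<one>\<^bsub>center_group M\<^esub> = \<one>\<^bsub>aut_level M 1\<^esub> 1 (punit M, [0, 1])"
    using punit_closed by (simp add: center_group_def ord_maps_edge)
  then show ?thesis
    using group_of_iso[OF subgroup.subgroup_is_group[OF subgroup_spheres_aut_1 G.group_axioms]
        spheres_iso_center] by simp
qed

lemma pi1_aut_iso_center: "pi_aut 1 M \<cong> center_group M"
proof -
  let ?K = "aut_level M 1\<lparr>carrier := spheres (aut_sset M) \<one>\<^bsub>aut_level M 0\<^esub> 1\<rparr>"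
  have "group ?K"
    by (rule subgroup.subgroup_is_group[OF subgroup_spheres_aut_1 group_aut_level])
  moreover have "?K \<cong> pi_aut 1 M" "?K \<cong> center_group M"
    using singleton_iso_pi1_aut spheres_iso_center by (auto intro: is_isoI)
  ultimately show ?thesis
    using group.iso_sym iso_trans by blast
qed

end

theorem mainTheorem5:
  fixes M :: "'a sset"
  assumes "partial_group M"
  shows "(group (pi0_aut M) \<and> group (Out_group M) \<and> pi0_aut M \<cong> Out_group M) \<and>
    (group (pi_aut 1 M) \<and> group (center_group M) \<and> pi_aut 1 M \<cong> center_group M) \<and>
    (\<forall>i\<ge>2. group (pi_aut i M) \<and> pi_aut i M \<cong> singleton_group (0::int))"
proof -
  interpret partial_group M by fact
  have "pi0_aut M \<cong> Out_group M"
    using pi0_aut_iso_Out by (rule is_isoI)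
  then show ?thesis
    by (intro conjI allI impI group_pi0_aut group_Out group_pi1_aut group_center
        pi1_aut_iso_center pi_aut_ge_2_trivial[THEN conjunct1] pi_aut_ge_2_trivial[THEN conjunct2])
qed

end
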